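(* Suppose $\boldsymbol\sigma>\mathbf 0$. If $F_{\mathbf R}$ has a density $f_{\mathbf R}$ on $\mathbb R^d$, then $H_R$ has the density $h_R$ given below; if $F_{\mathbf U}$ has a density $f_{\mathbf U}$ on $\mathbb R^d$, then $H_U$ has the density $h_U$ below; and if $F_{\mathbf T}$ has a density $f_{\mathbf T}$ on $\mathbb R^d$, then $H_T$ has the density $h_T$ below: $$h_R(\mathbf x)=\mathbf 1_{\{\mathbf x\nleq\mathbf 0\}}\frac{1}{\int_0^\infty\bar F_{\mathbf R}(t^{\boldsymbol\gamma}\frac{\boldsymbol\sigma}{\boldsymbol\gamma})\,dt}\int_0^\infty t^{\sum_{j=1}^d\gamma_j}f_{\mathbf R}\big(t^{\boldsymbol\gamma}(\mathbf x+\tfrac{\boldsymbol\sigma}{\boldsymbol\gamma})\big)\,dt,$$ $$h_U(\mathbf x)=\mathbf 1_{\{\mathbf x\nleq\mathbf 0\}}\frac{\prod_{j=1}^d(\gamma_jx_j+\sigma_j)^{-1}}{\int_0^\infty\bar F_{\mathbf U}(\log t)\,dt}\int_0^\infty f_{\mathbf U}\big(\tfrac1{\boldsymbol\gamma}\log(\tfrac{\boldsymbol\gamma}{\boldsymbol\sigma}\mathbf x+\mathbf 1)+\log t\big)\,dt,$$ $$h_T(\mathbf x)=\mathbf 1_{\{\mathbf x\nleq\mathbf 0\}}\frac{\prod_{j=1}^d(\gamma_jx_j+\sigma_j)^{-1}}{\bigvee_{j=1}^d(\frac{\gamma_j}{\sigma_j}x_j+1)^{1/\gamma_j}}\int_0^\infty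 t^{-1}f_{\mathbf T}\big(\tfrac1{\boldsymbol\gamma}\log(\tfrac{\boldsymbol\gamma}{\boldsymbol\sigma}\mathbf x+\mathbf 1)+\log t\big)\,dt,$$ for $\boldsymbol\gamma\mathbf x+\boldsymbol\sigma>\mathbf 0$, and where the densities are $0$ otherwise. If $\gamma_j=0$, then for $h_R$ the expressions $t^{\gamma_j}(x_j+\frac{\sigma_j}{\gamma_j})$ should be replaced by $x_j+\sigma_j\log t$; for $h_U$ and $h_T$, if $\gamma_j=0$, the expressions $\frac1{\gamma_j}\log(\frac{\gamma_j}{\sigma_j}x_j+1)$ should be replaced by their limits $x_j/\sigma_j$.
   Context: Notation. $\boldsymbol\gamma\in\mathbb R^d$; operations and relations on $d$-vectors are componentwise; $\wedge$ is minimum, $\bigvee$ maximum; $\mathbf x\nleq\mathbf y$ means not $\mathbf x\le\mathbf y$; $\mathbf 1_{\{\cdot\}}$ is an indicator, $\mathbf 1$ the vector of ones; $\bar F=1-F$; $F_{\mathbf Y}(\mathbf x)=\Pr[\mathbf Y\le\mathbf x]$; $\log t$ added to a vector is added to every component. For $\gamma=0$, $(1+\gamma x)^{1/\gamma}$ is read as $e^x$. Densities are with respect to Lebesgue measure on $\mathbb R^d$. $H_R$: the random vector $\mathbf R$ satisfies $R_j\in[0,\infty)$ if $\gamma_j>0$, $R_j\in[-\infty,\infty)$ if $\gamma_j=0$, $R_j\in[-\infty,0)$ if $\gamma_j<0$, and $0<\mathrm E[|R_j|^{1/\gamma_j}]<\infty$ if $\gamma_j\ne0$, $0<\mathrm E[\exp(R_j/\sigma_j)]<\infty$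 if $\gamma_j=0$, for all $j$; and $$H_R(\mathbf x)=\frac{\int_0^\infty\{F_{\mathbf R}(t^{\boldsymbol\gamma}(\mathbf x+\frac{\boldsymbol\sigma}{\boldsymbol\gamma}))-F_{\mathbf R}(t^{\boldsymbol\gamma}(\mathbf x\wedge\mathbf 0+\frac{\boldsymbol\sigma}{\boldsymbol\gamma}))\}\,dt}{\int_0^\infty\bar F_{\mathbf R}(t^{\boldsymbol\gamma}\frac{\boldsymbol\sigma}{\boldsymbol\gamma})\,dt}.$$ $H_U$: the random vector $\mathbf U$ satisfies $0<\mathrm E(e^{U_j})<\infty$ for all $j$, and $H_U$ is the cdf which for $\boldsymbol\gamma\mathbf x+\boldsymbol\sigma>\mathbf 0$ equals $$H_U(\mathbf x)=\frac{\int_0^\infty\{F_{\mathbf U}(\frac1{\boldsymbol\gamma}\log(\frac{\boldsymbol\gamma}{\boldsymbol\sigma}\mathbf x+1)+\log t)-F_{\mathbf U}(\frac1{\boldsymbol\gamma}\log(\frac{\boldsymbol\gamma}{\boldsymbol\sigma}(\mathbf x\wedge\mathbf 0)+1)+\log t)\}\,dt}{\int_0^\infty\bar F_{\mathbf U}(\log t)\,dt}.$$ $H_T$: for a random vector $\mathbf T$ put $\mathbf S=\mathbf T-\bigvee_{j=1}^dT_j$; $H_T$ is the cdf which for $\boldsymbol\gamma\mathbf x+\boldsymbol\sigma>\mathbf 0$ equals $$H_T(\mathbf x)=\int_0^1F_{\mathbf S}\big(\tfrac1{\boldsymbol\gamma}\log(\tfrac{\boldsymbol\gamma}{\boldsymbol\sigma}\mathbf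 x+1)+\log t\big)\,dt.$$ The conventions of the claim for $\gamma_j=0$ also apply in these formulas. *)

theory Defs
  imports "HOL-Probability.Probability"
begin

text \<open>
  Random vectors are maps \<open>Y :: 'a \<Rightarrow> 'd \<Rightarrow> ereal\<close>, with \<open>Y \<omega> j\<close> the \<open>j\<close>-th component, since
  components may take the value \<open>-\<infinity>\<close>. Distribution functions are evaluated at points of
  \<open>real ^ 'd\<close>, on which the library order \<open>\<le>\<close> is componentwise.
\<close>

definition random_vector :: "'a measure \<Rightarrow> ('a \<Rightarrow> 'd \<Rightarrow> ereal) \<Rightarrow> bool" where
  "random_vector M Y \<longleftrightarrow> (\<forall>j. (\<lambda>\<omega>. Y \<omega> j) \<in> borel_measurable M)"

definition dist_fun :: "'a measure \<Rightarrow> ('a \<Rightarrow> 'd::finite \<Rightarrow> ereal) \<Rightarrow> real ^ 'd \<Rightarrow> real" where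
  "dist_fun M Y x = measure M {\<omega> \<in> space M. \<forall>j. Y \<omega> j \<le> ereal (x $ j)}"

definition is_cdf :: "(real ^ 'd::finite \<Rightarrow> real) \<Rightarrow> bool" where
  "is_cdf F \<longleftrightarrow> (\<exists>P. prob_space P \<and> sets P = sets borel \<and> (\<forall>x. F x = measure P {..x}))"

text \<open>
  \<open>F\<close> is the distribution function of the probability measure on \<open>real ^ 'd\<close> with Lebesgue
  density \<open>f\<close>. Applied to \<open>dist_fun M Y\<close>, this forces \<open>Y\<close> to be almost surely finite, because
  the total mass of \<open>f\<close> is one.
\<close>

definition has_density :: "(real ^ 'd::finite \<Rightarrow> real) \<Rightarrow> (real ^ 'd \<Rightarrow> real) \<Rightarrow> bool" where
  "has_density F f \<longleftrightarrow>
     f \<in> borel_measurable borel \<and> (\<forall>x. 0 \<le> f x) \<and>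
     prob_space (density lborel (\<lambda>y. ennreal (f y))) \<and>
     (\<forall>x. F x = measure (density lborel (\<lambda>y. ennreal (f y))) {..x})"

text \<open>\<open>e\<^sup>y\<close> and \<open>|y|\<^sup>p\<close> (for \<open>p \<noteq> 0\<close>) with their limiting values at \<open>\<plusminus>\<infinity>\<close> and at \<open>0\<close>.\<close>

definition ext_exp :: "ereal \<Rightarrow> ennreal" where
  "ext_exp y = (case y of ereal r \<Rightarrow> ennreal (exp r) | PInfty \<Rightarrow> \<infinity> | MInfty \<Rightarrow> 0)"

definition ext_abs_powr :: "ereal \<Rightarrow> real \<Rightarrow> ennreal" where
  "ext_abs_powr y p =
     (if \<bar>y\<bar> = \<infinity> then (if p < 0 then 0 else \<infinity>)
      else if y = 0 \<and> p < 0 then \<infinity>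
      else ennreal (\<bar>real_of_ereal y\<bar> powr p))"

definition gp_domain :: "real ^ 'd::finite \<Rightarrow> real ^ 'd \<Rightarrow> (real ^ 'd) set" where
  "gp_domain \<gamma> \<sigma> = {x. \<forall>j. \<gamma> $ j * x $ j + \<sigma> $ j > 0}"

definition neg_part_vec :: "real ^ 'd::finite \<Rightarrow> real ^ 'd" where
  "neg_part_vec x = (\<chi> j. min (x $ j) 0)"

text \<open>
  \<open>gp_scale \<gamma> \<sigma> t x\<close> is \<open>t\<^sup>\<gamma> (x + \<sigma>/\<gamma>)\<close>, and \<open>gp_std \<gamma> \<sigma> x\<close> is \<open>(1/\<gamma>) log ((\<gamma>/\<sigma>) x + 1)\<close>,
  componentwise; in the components with \<open>\<gamma>\<^sub>j = 0\<close> these are read as \<open>x\<^sub>j + \<sigma>\<^sub>j log t\<close> and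
  \<open>x\<^sub>j / \<sigma>\<^sub>j\<close>.
\<close>

definition gp_scale :: "real ^ 'd::finite \<Rightarrow> real ^ 'd \<Rightarrow> real \<Rightarrow> real ^ 'd \<Rightarrow> real ^ 'd" where
  "gp_scale \<gamma> \<sigma> t x =
     (\<chi> j. if \<gamma> $ j = 0 then x $ j + \<sigma> $ j * ln t
           else t powr (\<gamma> $ j) * (x $ j + \<sigma> $ j / \<gamma> $ j))"

definition gp_std :: "real ^ 'd::finite \<Rightarrow> real ^ 'd \<Rightarrow> real ^ 'd \<Rightarrow> real ^ 'd" where
  "gp_std \<gamma> \<sigma> x =
     (\<chi> j. if \<gamma> $ j = 0 then x $ j / \<sigma> $ j
           else 1 / \<gamma> $ j * ln (\<gamma> $ j / \<sigma> $ j * x $ j + 1))"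

definition add_scalar :: "real ^ 'd::finite \<Rightarrow> real \<Rightarrow> real ^ 'd" where
  "add_scalar y s = (\<chi> j. y $ j + s)"

text \<open>
  The distribution function given by \<open>G\<close> on \<open>D\<close>; it is meaningful only if there is exactly one,
  so any property claimed of it includes existence and uniqueness.
\<close>

definition the_cdf_on :: "(real ^ 'd::finite) set \<Rightarrow> (real ^ 'd \<Rightarrow> real) \<Rightarrow> real ^ 'd \<Rightarrow> real" where
  "the_cdf_on D G = (THE H. is_cdf H \<and> (\<forall>x\<in>D. H x = G x))"


definition R_admissible ::
  "real ^ 'd::finite \<Rightarrow> real ^ 'd \<Rightarrow> 'a measure \<Rightarrow> ('a \<Rightarrow> 'd \<Rightarrow> ereal) \<Rightarrow> bool" where
  "R_admissible \<gamma> \<sigma> M R \<longleftrightarrow>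
     (\<forall>j. (\<gamma> $ j > 0 \<longrightarrow> (AE \<omega> in M. 0 \<le> R \<omega> j \<and> R \<omega> j < \<infinity>)) \<and>
          (\<gamma> $ j = 0 \<longrightarrow> (AE \<omega> in M. R \<omega> j < \<infinity>)) \<and>
          (\<gamma> $ j < 0 \<longrightarrow> (AE \<omega> in M. R \<omega> j < 0)) \<and>
          (\<gamma> $ j \<noteq> 0 \<longrightarrow>
             0 < (\<integral>\<^sup>+ \<omega>. ext_abs_powr (R \<omega> j) (1 / \<gamma> $ j) \<partial>M) \<and>
             (\<integral>\<^sup>+ \<omega>. ext_abs_powr (R \<omega> j) (1 / \<gamma> $ j) \<partial>M) < \<infinity>) \<and>
          (\<gamma> $ j = 0 \<longrightarrow>
             0 < (\<integral>\<^sup>+ \<omega>. ext_exp (R \<omega> j / ereal (\<sigma> $ j)) \<partial>M) \<and>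
             (\<integral>\<^sup>+ \<omega>. ext_exp (R \<omega> j / ereal (\<sigma> $ j)) \<partial>M) < \<infinity>))"

definition U_admissible :: "'a measure \<Rightarrow> ('a \<Rightarrow> 'd::finite \<Rightarrow> ereal) \<Rightarrow> bool" where
  "U_admissible M U \<longleftrightarrow>
     (\<forall>j. 0 < (\<integral>\<^sup>+ \<omega>. ext_exp (U \<omega> j) \<partial>M) \<and> (\<integral>\<^sup>+ \<omega>. ext_exp (U \<omega> j) \<partial>M) < \<infinity>)"

definition spectral :: "('a \<Rightarrow> 'd::finite \<Rightarrow> ereal) \<Rightarrow> 'a \<Rightarrow> 'd \<Rightarrow> ereal" where
  "spectral T \<omega> j = T \<omega> j - Max (range (T \<omega>))"


definition R_denom ::
  "real ^ 'd::finite \<Rightarrow> real ^ 'd \<Rightarrow> (real ^ 'd \<Rightarrow> real) \<Rightarrow> real" where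
  "R_denom \<gamma> \<sigma> F = (LBINT t:{0<..}. 1 - F (gp_scale \<gamma> \<sigma> t 0))"

definition H_R ::
  "real ^ 'd::finite \<Rightarrow> real ^ 'd \<Rightarrow> 'a measure \<Rightarrow> ('a \<Rightarrow> 'd \<Rightarrow> ereal) \<Rightarrow> real ^ 'd \<Rightarrow> real" where
  "H_R \<gamma> \<sigma> M R x =
     (LBINT t:{0<..}. dist_fun M R (gp_scale \<gamma> \<sigma> t x)
                       - dist_fun M R (gp_scale \<gamma> \<sigma> t (neg_part_vec x)))
     / R_denom \<gamma> \<sigma> (dist_fun M R)"

definition U_denom :: "(real ^ 'd::finite \<Rightarrow> real) \<Rightarrow> real" where
  "U_denom F = (LBINT t:{0<..}. 1 - F (\<chi> j. ln t))"

definition H_U ::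
  "real ^ 'd::finite \<Rightarrow> real ^ 'd \<Rightarrow> 'a measure \<Rightarrow> ('a \<Rightarrow> 'd \<Rightarrow> ereal) \<Rightarrow> real ^ 'd \<Rightarrow> real" where
  "H_U \<gamma> \<sigma> M U = the_cdf_on (gp_domain \<gamma> \<sigma>) (\<lambda>x.
     (LBINT t:{0<..}. dist_fun M U (add_scalar (gp_std \<gamma> \<sigma> x) (ln t))
                       - dist_fun M U (add_scalar (gp_std \<gamma> \<sigma> (neg_part_vec x)) (ln t)))
     / U_denom (dist_fun M U))"

definition H_T ::
  "real ^ 'd::finite \<Rightarrow> real ^ 'd \<Rightarrow> 'a measure \<Rightarrow> ('a \<Rightarrow> 'd \<Rightarrow> ereal) \<Rightarrow> real ^ 'd \<Rightarrow> real" where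
  "H_T \<gamma> \<sigma> M T = the_cdf_on (gp_domain \<gamma> \<sigma>) (\<lambda>x.
     LBINT t:{0<..<1}. dist_fun M (spectral T) (add_scalar (gp_std \<gamma> \<sigma> x) (ln t)))"


definition h_R ::
  "real ^ 'd::finite \<Rightarrow> real ^ 'd \<Rightarrow> (real ^ 'd \<Rightarrow> real) \<Rightarrow> (real ^ 'd \<Rightarrow> real) \<Rightarrow> real ^ 'd \<Rightarrow> real"
  where
  "h_R \<gamma> \<sigma> F f x =
     (if x \<in> gp_domain \<gamma> \<sigma> \<and> \<not> x \<le> 0
      then 1 / R_denom \<gamma> \<sigma> F * (LBINT t:{0<..}. t powr (\<Sum>j\<in>UNIV. \<gamma> $ j) * f (gp_scale \<gamma> \<sigma> t x))
      else 0)"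

definition h_U ::
  "real ^ 'd::finite \<Rightarrow> real ^ 'd \<Rightarrow> (real ^ 'd \<Rightarrow> real) \<Rightarrow> (real ^ 'd \<Rightarrow> real) \<Rightarrow> real ^ 'd \<Rightarrow> real"
  where
  "h_U \<gamma> \<sigma> F f x =
     (if x \<in> gp_domain \<gamma> \<sigma> \<and> \<not> x \<le> 0
      then (\<Prod>j\<in>UNIV. inverse (\<gamma> $ j * x $ j + \<sigma> $ j)) / U_denom F
           * (LBINT t:{0<..}. f (add_scalar (gp_std \<gamma> \<sigma> x) (ln t)))
      else 0)"

text \<open>\<open>(\<gamma>\<^sub>j/\<sigma>\<^sub>j x\<^sub>j + 1)\<close> to the power \<open>1/\<gamma>\<^sub>j\<close>, read as \<open>exp (x\<^sub>j/\<sigma>\<^sub>j)\<close> if \<open>\<gamma>\<^sub>j = 0\<close>.\<close>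

definition gp_pareto :: "real ^ 'd::finite \<Rightarrow> real ^ 'd \<Rightarrow> real ^ 'd \<Rightarrow> 'd \<Rightarrow> real" where
  "gp_pareto \<gamma> \<sigma> x j =
     (if \<gamma> $ j = 0 then exp (x $ j / \<sigma> $ j)
      else (\<gamma> $ j / \<sigma> $ j * x $ j + 1) powr (1 / \<gamma> $ j))"

definition h_T ::
  "real ^ 'd::finite \<Rightarrow> real ^ 'd \<Rightarrow> (real ^ 'd \<Rightarrow> real) \<Rightarrow> real ^ 'd \<Rightarrow> real"
  where
  "h_T \<gamma> \<sigma> f x =
     (if x \<in> gp_domain \<gamma> \<sigma> \<and> \<not> x \<le> 0
      then (\<Prod>j\<in>UNIV. inverse (\<gamma> $ j * x $ j + \<sigma> $ j)) / Max (range (gp_pareto \<gamma> \<sigma> x))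
           * (LBINT t:{0<..}. inverse t * f (add_scalar (gp_std \<gamma> \<sigma> x) (ln t)))
      else 0)"

end

theory Submission
  imports Defs
begin

text \<open>
  All three densities arise from one scheme. Let \<open>s t\<close>, \<open>t > 0\<close>, be a family of componentwise
  increasing maps: \<open>s t y = t\<^sup>\<gamma> (y + \<sigma>/\<gamma>)\<close> for \<open>R\<close>, and \<open>s t y = (1/\<gamma>) log ((\<gamma>/\<sigma>) y + 1) + log t\<close>
  for \<open>U\<close> and \<open>T\<close>. On the domain \<open>\<gamma> y + \<sigma> > 0\<close> each map is a diffeomorphism with a diagonal
  Jacobian, whose determinant \<open>J t y\<close> is \<open>t\<close> to the power \<open>\<Sum>\<^sub>j \<gamma>\<^sub>j\<close> in the first case and
  \<open>\<Prod>\<^sub>j (\<gamma>\<^sub>j y\<^sub>j + \<sigma>\<^sub>j)\<^sup>-\<^sup>1\<close> in the second. For a weight \<open>\<phi> \<ge> 0\<close>, Fubini's theorem and the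
  substitution \<open>z = s t y\<close> turn the integral of \<open>\<integral>\<^sub>0\<^sup>\<infinity> J t y \<phi> (s t y) dt\<close> over the points \<open>y \<le> x\<close> with
  not \<open>y \<le> 0\<close> into \<open>\<integral>\<^sub>0\<^sup>\<infinity> \<phi>{z. z \<le> s t x \<and> \<not> z \<le> s t 0} dt\<close>, where \<open>\<phi>\<close> is also read as a measure
  (\<open>mixture_density\<close>).

  For \<open>R\<close> and \<open>U\<close> the weight is the given density. Monotonicity of \<open>s t\<close> gives
  \<open>{z. z \<le> s t x \<and> \<not> z \<le> s t 0} = {..s t x} - {..s t (x \<and> 0)}\<close>, so the result is the numerator of
  the distribution function. The total mass is the denominator; it is the expectation of the
  maximum of positive variables \<open>V\<^sub>j\<close>, which the moment conditions make finite
  (\<open>normalised_mixture_density\<close>). For \<open>T\<close> the weight is \<open>exp (- max\<^sub>j z\<^sub>j)\<close> times the density: the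
  reciprocal of the maximum in front of the integral and \<open>t\<^sup>-\<^sup>1\<close> inside it combine to this exponential,
  and rescaling \<open>t\<close> by \<open>exp (max\<^sub>j z\<^sub>j)\<close> produces the law of \<open>T - max\<^sub>j T\<^sub>j\<close>.

  Two points remain. The substitution rule is proved componentwise
  (\<open>nn_integral_componentwise_substitution\<close>), which needs only one-dimensional calculus. And
  \<open>H\<^sub>U\<close>, \<open>H\<^sub>T\<close> are specified only on the domain, so it must be shown that no other
  distribution function agrees there with that of a law concentrated on the domain
  (\<open>has_density_the_cdf_on\<close>).
\<close>

section \<open>Random vectors and their laws\<close>

lemma borel_measurable_vec_lambda [measurable (raw)]:
  fixes g :: "'d::finite \<Rightarrow> 'b \<Rightarrow> real"
  assumes [measurable]: "\<And>j. g j \<in> borel_measurable N"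
  shows "(\<lambda>x. \<chi> j. g j x) \<in> borel_measurable N"
proof -
  have "(\<lambda>x. (\<chi> j. g j x) \<bullet> b) \<in> borel_measurable N" if "b \<in> Basis" for b :: "real ^ 'd"
    using that by (auto simp: Basis_vec_def inner_axis)
  then show ?thesis
    by (subst borel_measurable_euclidean_space) auto
qed

lemma borel_measurable_vec_nth [measurable (raw)]:
  fixes g :: "'b \<Rightarrow> real ^ 'd::finite"
  assumes "g \<in> borel_measurable N"
  shows "(\<lambda>x. g x $ j) \<in> borel_measurable N"
  by (rule measurable_compose[OF assms borel_measurable_nth])

lemma borel_measurable_vec_le [measurable (raw)]:
  fixes g h :: "'b \<Rightarrow> real ^ 'd::finite"
  assumes [measurable]: "g \<in> borel_measurable N" "h \<in> borel_measurable N"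
  shows "Measurable.pred N (\<lambda>x. g x \<le> h x)"
  unfolding less_eq_vec_def by measurable

lemma Union_atMost_const: "(\<Union>n::nat. {..(\<chi> j::'d::finite. real n)}) = UNIV"
proof (intro set_eqI iffI UNIV_I)
  fix x :: "real ^ 'd"
  obtain n :: nat where "Max (range (($) x)) \<le> real n" using real_arch_simple by blast
  then have "x $ k \<le> real n" for k by simp
  then show "x \<in> (\<Union>n. {..(\<chi> j. real n)})" by (auto simp: less_eq_vec_def)
qed

text \<open>
  The lower orthants \<open>{..x}\<close> form an intersection-stable generator of the Borel sets.
\<close>
lemma measure_eq_if_atMost_eq:
  fixes N P :: "(real ^ 'd::finite) measure"
  assumes "prob_space N" "prob_space P" "sets N = sets borel" "sets P = sets borel"
    and "\<And>x. measure N {..x} = measure P {..x}"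
  shows "N = P"
proof -
  interpret N: prob_space N by fact
  interpret P: prob_space P by fact
  have gen: "sets (borel :: (real ^ 'd) measure) = sigma_sets UNIV (range (\<lambda>a. {..a}))"
    by (subst borel_eq_atMost) simp
  let ?E = "range (\<lambda>a::real^'d. {..a})"
  show ?thesis
  proof (rule measure_eqI_generator_eq[where E = ?E and \<Omega> = UNIV and A = "\<lambda>n. {..(\<chi> j. real n)}"])
    show "Int_stable ?E"
    proof (rule Int_stableI_image)
      fix a b :: "real ^ 'd"
      have "{..a} \<inter> {..b} = {..(\<chi> j. min (a $ j) (b $ j))}"
        by (auto simp: less_eq_vec_def)
      then show "\<exists>k\<in>UNIV. {..a} \<inter> {..b} = {..k}" by blast
    qed
    show "emeasure N X = emeasure P X" if "X \<in> ?E" for X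
      using that assms(5) by (auto simp: N.emeasure_eq_measure P.emeasure_eq_measure)
    show "(\<Union>n. {..(\<chi> j. real n) :: real ^ 'd}) = UNIV"
      by (rule Union_atMost_const)
  qed (use assms(3,4) in \<open>auto simp: gen\<close>)
qed

lemma has_densityD:
  assumes "has_density F f"
  shows "f \<in> borel_measurable borel" "\<And>x. 0 \<le> f x"
    "prob_space (density lborel (\<lambda>y. ennreal (f y)))"
    "\<And>x. F x = measure (density lborel (\<lambda>y. ennreal (f y))) {..x}"
  using assms by (auto simp: has_density_def)

text \<open>
  A random vector whose distribution function has a Lebesgue density is almost surely finite: letting
  all components tend to infinity excludes the value \<open>\<infinity>\<close>, and letting one component tend to minus
  infinity excludes \<open>-\<infinity>\<close>. It may therefore be replaced by a genuine \<open>real ^ 'd\<close>-valued variable,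
  whose law is the measure with that density.
\<close>
lemma real_random_vector_of_density:
  fixes Y :: "'a \<Rightarrow> 'd::finite \<Rightarrow> ereal"
  assumes "prob_space M" "random_vector M Y" "has_density (dist_fun M Y) f"
  obtains Z :: "'a \<Rightarrow> real ^ 'd" where "Z \<in> borel_measurable M"
    "AE \<omega> in M. \<forall>j. Y \<omega> j = ereal (Z \<omega> $ j)"
    "distr M borel Z = density lborel (\<lambda>y. ennreal (f y))"
proof -
  interpret M: prob_space M by fact
  define P where "P = density lborel (\<lambda>y. ennreal (f y))"
  interpret P: prob_space P using has_densityD(3)[OF assms(3)] by (simp add: P_def)
  have [measurable_cong]: "sets P = sets borel" by (simp add: P_def)
  have [simp]: "space P = UNIV" by (simp add: P_def)
  have F: "measure M {\<omega>\<in>space M. \<forall>j. Y \<omega> j \<le> ereal (x $ j)} = measure P {..x}" for x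
    using has_densityD(4)[OF assms(3), of x] by (simp add: dist_fun_def P_def)
  have Y[measurable]: "(\<lambda>\<omega>. Y \<omega> j) \<in> borel_measurable M" for j
    using assms(2) by (simp add: random_vector_def)
  have le: "(\<forall>j. Y \<omega> j \<le> ereal (real n)) \<Longrightarrow> n \<le> m \<Longrightarrow> (\<forall>j. Y \<omega> j \<le> ereal (real m))" for \<omega> n m
    using order_trans[of "Y \<omega> _" "ereal (real n)" "ereal (real m)"] by auto
  have below: "AE \<omega> in M. \<forall>j. Y \<omega> j < \<infinity>"
  proof -
    let ?B = "\<lambda>n::nat. {\<omega>\<in>space M. \<forall>j. Y \<omega> j \<le> ereal (real n)}"
    have "(\<lambda>n. measure P {..(\<chi> j. real n)}) \<longlonglongrightarrow> measure P (\<Union>n. {..(\<chi> j. real n)})"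
      by (intro P.finite_Lim_measure_incseq) (auto simp: incseq_def less_eq_vec_def intro: order_trans)
    then have 1: "(\<lambda>n. measure M (?B n)) \<longlonglongrightarrow> 1"
      using F[of "\<chi> j. real _"] P.prob_space by (simp add: Union_atMost_const)
    have 2: "(\<lambda>n. measure M (?B n)) \<longlonglongrightarrow> measure M (\<Union>n. ?B n)"
      by (intro M.finite_Lim_measure_incseq) (auto simp: incseq_def dest: le)
    have "M.prob (\<Union>n. ?B n) = 1" by (rule LIMSEQ_unique[OF 2 1])
    then have "AE \<omega> in M. \<omega> \<in> (\<Union>n. ?B n)"
      by (subst M.prob_eq_1[symmetric]) auto
    then show ?thesis
    proof eventually_elim
      case (elim \<omega>)
      then obtain n :: nat where n: "\<forall>j. Y \<omega> j \<le> ereal (real n)" by auto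
      show ?case
      proof
        fix j show "Y \<omega> j < \<infinity>" using n[rule_format, of j] by (cases "Y \<omega> j") auto
      qed
    qed
  qed
  have above: "AE \<omega> in M. Y \<omega> j \<noteq> -\<infinity>" for j
  proof -
    let ?x = "\<lambda>m n. (\<chi> k. if k = j then - real n else real m) :: real ^ 'd"
    have "AE \<omega> in M. \<not> (Y \<omega> j = -\<infinity> \<and> (\<forall>k. Y \<omega> k \<le> ereal (real m)))" for m
    proof -
      let ?N = "{\<omega>\<in>space M. Y \<omega> j = -\<infinity> \<and> (\<forall>k. Y \<omega> k \<le> ereal (real m))}"
      have "measure M ?N \<le> measure P {..?x m n}" for n
        unfolding F[symmetric] by (intro M.finite_measure_mono) auto
      moreover have "(\<lambda>n. measure P {..?x m n}) \<longlonglongrightarrow> measure P (\<Inter>n. {..?x m n})"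
        by (intro P.finite_Lim_measure_decseq) (auto simp: decseq_def less_eq_vec_def intro: order_trans)
      moreover have "(\<Inter>n. {..?x m n}) = {}"
      proof (rule ccontr)
        assume "(\<Inter>n. {..?x m n}) \<noteq> {}"
        then obtain x where x: "\<And>n. x \<in> {..?x m n}" by blast
        have xj: "x $ j \<le> - real n" for n
          using x[of n] by (auto simp: less_eq_vec_def dest: spec[of _ j])
        obtain n where "- x $ j < real n" using reals_Archimedean2 by blast
        with xj[of n] show False by simp
      qed
      ultimately have "measure M ?N \<le> 0"
        by (intro LIMSEQ_le_const[where X = "\<lambda>n. measure P {..?x m n}"]) auto
      then have "measure M ?N = 0" by (simp add: measure_le_0_iff)
      then have "?N \<in> null_sets M" by (auto simp: null_sets_def M.emeasure_eq_measure)
      from AE_not_in[OF this] AE_space show ?thesis by eventually_elim auto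
    qed
    then have "AE \<omega> in M. \<forall>m. \<not> (Y \<omega> j = -\<infinity> \<and> (\<forall>k. Y \<omega> k \<le> ereal (real m)))"
      by (subst AE_all_countable) blast
    then show ?thesis
      using below
    proof eventually_elim
      case (elim \<omega>)
      obtain m :: nat where m: "Max (range (\<lambda>k. real_of_ereal (Y \<omega> k))) \<le> real m" using real_arch_simple by blast
      have "Y \<omega> k \<le> ereal (real m)" for k
      proof -
        have "real_of_ereal (Y \<omega> k) \<le> real m" using m by simp
        then show ?thesis using elim(2) by (cases "Y \<omega> k") (auto dest: spec[of _ k])
      qed
      then show ?case using elim(1) by auto
    qed
  qed
  define Z where "Z \<omega> = (\<chi> j. real_of_ereal (Y \<omega> j))" for \<omega>
  have [measurable]: "Z \<in> borel_measurable M" unfolding Z_def by measurable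
  have "AE \<omega> in M. \<forall>j. Y \<omega> j \<noteq> -\<infinity>" using above by (simp add: AE_all_countable)
  then have eq: "AE \<omega> in M. \<forall>j. Y \<omega> j = ereal (Z \<omega> $ j)"
    using below
  proof eventually_elim
    case (elim \<omega>)
    show ?case
    proof
      fix j show "Y \<omega> j = ereal (Z \<omega> $ j)"
        using elim by (cases "Y \<omega> j") (auto simp: Z_def dest!: spec[of _ j])
    qed
  qed
  have "distr M borel Z = P"
  proof (rule measure_eq_if_atMost_eq)
    show "prob_space (distr M borel Z)" by (rule M.prob_space_distr) simp
    fix x :: "real ^ 'd"
    have "measure (distr M borel Z) {..x} = measure M {\<omega>\<in>space M. Z \<omega> \<le> x}"
      by (subst measure_distr) (auto intro!: arg_cong[where f = "measure M"])
    also have "\<dots> = measure M {\<omega>\<in>space M. \<forall>j. Y \<omega> j \<le> ereal (x $ j)}"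
      using eq by (intro M.finite_measure_eq_AE) (auto simp: less_eq_vec_def elim!: eventually_mono)
    finally show "measure (distr M borel Z) {..x} = measure P {..x}" by (simp add: F)
  qed (auto simp: P_def[symmetric] P.prob_space_axioms \<open>sets P = sets borel\<close>)
  then show thesis using eq that[of Z] by (simp add: P_def)
qed

section \<open>Componentwise substitution\<close>

lemma prod_Basis_vec: "(\<Prod>b\<in>(Basis :: (real ^ 'd::finite) set). g b) = (\<Prod>j\<in>UNIV. g (axis j 1))"
proof -
  have *: "(Basis :: (real ^ 'd) set) = range (\<lambda>j. axis j 1)" by (auto simp: Basis_vec_def)
  have "inj (\<lambda>j. axis j (1::real) :: real ^ 'd)" by (auto intro!: injI simp: axis_eq_axis)
  then show ?thesis unfolding * by (subst prod.reindex) (simp_all add: o_def)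
qed

lemma nn_integral_prod_vec:
  fixes g :: "'d::finite \<Rightarrow> real \<Rightarrow> ennreal"
  assumes [measurable]: "\<And>j. g j \<in> borel_measurable borel"
  shows "(\<integral>\<^sup>+ x. (\<Prod>j\<in>UNIV. g j (x $ j)) \<partial>lborel) = (\<Prod>j\<in>UNIV. \<integral>\<^sup>+ s. g j s \<partial>lborel)"
proof -
  define g' where "g' b = g (THE j. b = axis j (1::real))" for b
  have g': "g' (axis j 1) = g j" for j
    by (simp add: g'_def axis_eq_axis)
  have "(\<integral>\<^sup>+ x. (\<Prod>b\<in>Basis. g' b (x \<bullet> b)) \<partial>(lborel :: (real ^ 'd) measure))
      = (\<Prod>b\<in>Basis. \<integral>\<^sup>+ s. g' b s \<partial>lborel)"
    by (intro nn_integral_lborel_prod) (auto simp: Basis_vec_def g')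
  then show ?thesis by (simp add: prod_Basis_vec g' inner_axis)
qed

text \<open>
  Substitution along a map acting componentwise. If in every coordinate the weighted Lebesgue measure
  is carried to Lebesgue measure on intervals, then the product weight carries Lebesgue measure on
  \<open>real ^ 'd\<close> to itself, because boxes determine Lebesgue measure. Weights may vanish, so that the
  map need only be meaningful where they do not.
\<close>
lemma nn_integral_componentwise_substitution:
  fixes w :: "'d::finite \<Rightarrow> real \<Rightarrow> ennreal" and \<phi> :: "'d \<Rightarrow> real \<Rightarrow> real"
    and g :: "real ^ 'd \<Rightarrow> ennreal"
  assumes [measurable]: "\<And>j. w j \<in> borel_measurable borel" "\<And>j. \<phi> j \<in> borel_measurable borel"
    "g \<in> borel_measurable borel"
    and one_dim: "\<And>j a b. a \<le> b \<Longrightarrow> (\<integral>\<^sup>+ s. w j s * indicator {a<..<b} (\<phi> j s) \<partial>lborel) = ennreal (b - a)"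
  shows "(\<integral>\<^sup>+ x. (\<Prod>j\<in>UNIV. w j (x $ j)) * g (\<chi> j. \<phi> j (x $ j)) \<partial>lborel) = (\<integral>\<^sup>+ y. g y \<partial>lborel)"
proof -
  let ?\<Phi> = "\<lambda>x :: real ^ 'd. (\<chi> j. \<phi> j (x $ j)) :: real ^ 'd"
  let ?W = "\<lambda>x :: real ^ 'd. \<Prod>j\<in>UNIV. w j (x $ j)"
  have [measurable]: "?\<Phi> \<in> borel_measurable borel" by measurable
  have [measurable]: "?W \<in> borel_measurable borel" by measurable
  have "(lborel :: (real ^ 'd) measure) = distr (density lborel ?W) borel ?\<Phi>"
  proof (rule lborel_eqI)
    fix l u :: "real ^ 'd" assume "\<And>b. b \<in> Basis \<Longrightarrow> l \<bullet> b \<le> u \<bullet> b"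
    then have lu: "l $ j \<le> u $ j" for j
      by (metis axis_in_Basis_iff cart_eq_inner_axis Basis_real_def insertI1)
    have "emeasure (distr (density lborel ?W) borel ?\<Phi>) (box l u)
        = (\<integral>\<^sup>+ y. indicator (box l u) y \<partial>distr (density lborel ?W) borel ?\<Phi>)"
      by simp
    also have "\<dots> = (\<integral>\<^sup>+ x. ?W x * indicator (box l u) (?\<Phi> x) \<partial>lborel)"
      by (simp add: nn_integral_distr nn_integral_density del: nn_integral_indicator)
    also have "\<dots> = (\<integral>\<^sup>+ x. (\<Prod>j\<in>UNIV. w j (x $ j) * indicator {l $ j<..<u $ j} (\<phi> j (x $ j))) \<partial>lborel)"
    proof (intro nn_integral_cong)
      fix x :: "real ^ 'd"
      have "indicator (box l u) (?\<Phi> x) = (\<Prod>j\<in>UNIV. indicator {l $ j<..<u $ j} (\<phi> j (x $ j)) :: ennreal)"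
        by (auto simp: indicator_def prod_zero_iff mem_box_cart prod.neutral)
      then show "?W x * indicator (box l u) (?\<Phi> x)
          = (\<Prod>j\<in>UNIV. w j (x $ j) * indicator {l $ j<..<u $ j} (\<phi> j (x $ j)))"
        by (simp add: prod.distrib)
    qed
    also have "\<dots> = (\<Prod>j\<in>UNIV. \<integral>\<^sup>+ s. w j s * indicator {l $ j<..<u $ j} (\<phi> j s) \<partial>lborel)"
      by (rule nn_integral_prod_vec) measurable
    also have "\<dots> = (\<Prod>j\<in>UNIV. ennreal (u $ j - l $ j))"
      by (simp add: one_dim lu)
    also have "\<dots> = ennreal (\<Prod>b\<in>Basis. (u - l) \<bullet> b)"
      by (simp add: prod_Basis_vec inner_axis prod_ennreal lu)
    finally show "emeasure (distr (density lborel ?W) borel ?\<Phi>) (box l u)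
        = ennreal (\<Prod>b\<in>Basis. (u - l) \<bullet> b)" .
  qed simp
  then have "(\<integral>\<^sup>+ y. g y \<partial>lborel) = (\<integral>\<^sup>+ y. g y \<partial>distr (density lborel ?W) borel ?\<Phi>)" by simp
  also have "\<dots> = (\<integral>\<^sup>+ x. ?W x * g (?\<Phi> x) \<partial>lborel)"
    by (simp add: nn_integral_distr nn_integral_density)
  finally show ?thesis by simp
qed

section \<open>Mixtures over a scaling family\<close>

text \<open>
  The common structure of the maps \<open>s t\<close>, with Jacobian determinant \<open>J t\<close>: the substitution rule for
  \<open>z = s t y\<close> holds from \<open>D\<close> onto \<open>E\<close>, and \<open>s t\<close> preserves and reflects the order between points of \<open>D\<close>
  and points of \<open>X\<close>, and commutes on \<open>X\<close> with taking componentwise minima with 0. The set \<open>X\<close>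
  contains the arguments at which the distribution function is evaluated by an explicit formula; it is
  everything in the case of \<open>H\<^sub>R\<close>, and the domain in the cases of \<open>H\<^sub>U\<close> and \<open>H\<^sub>T\<close>.
\<close>
locale scaling_family =
  fixes D X E :: "(real ^ 'd::finite) set"
    and s :: "real \<Rightarrow> real ^ 'd \<Rightarrow> real ^ 'd" and J :: "real \<Rightarrow> real ^ 'd \<Rightarrow> real"
  assumes D_sets [measurable]: "D \<in> sets borel" and E_sets [measurable]: "E \<in> sets borel"
    and s_measurable [measurable]: "(\<lambda>(t, y). s t y) \<in> borel_measurable (borel \<Otimes>\<^sub>M borel)"
    and J_measurable [measurable]: "(\<lambda>(t, y). J t y) \<in> borel_measurable (borel \<Otimes>\<^sub>M borel)"
    and J_nonneg: "\<And>t y. y \<in> D \<Longrightarrow> 0 < t \<Longrightarrow> 0 \<le> J t y"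
    and substitution: "\<And>t g. 0 < t \<Longrightarrow> g \<in> borel_measurable borel \<Longrightarrow>
      (\<integral>\<^sup>+ y. indicator D y * ennreal (J t y) * g (s t y) \<partial>lborel) = (\<integral>\<^sup>+ z. indicator E z * g z \<partial>lborel)"
    and s_le_iff: "\<And>t x y. 0 < t \<Longrightarrow> x \<in> X \<Longrightarrow> y \<in> D \<Longrightarrow> s t y \<le> s t x \<longleftrightarrow> y \<le> x"
    and zero_in_X: "0 \<in> X"
    and le_s_neg_part_iff: "\<And>t x z. 0 < t \<Longrightarrow> x \<in> X \<Longrightarrow>
      z \<le> s t (neg_part_vec x) \<longleftrightarrow> z \<le> s t x \<and> z \<le> s t 0"
begin

text \<open>
  Interchange the integrals over \<open>y\<close> and \<open>t\<close>, then substitute \<open>z = s t y\<close> in the inner one.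
\<close>
lemma Fubini_scaling:
  fixes \<phi> :: "real ^ 'd \<Rightarrow> ennreal"
  assumes [measurable]: "\<phi> \<in> borel_measurable borel" "A \<in> sets borel"
    "Measurable.pred (borel \<Otimes>\<^sub>M borel) (\<lambda>(t, z). z \<in> B t)"
    and AB: "\<And>t y. 0 < t \<Longrightarrow> y \<in> D \<Longrightarrow> y \<in> A \<longleftrightarrow> s t y \<in> B t"
  shows "(\<integral>\<^sup>+ y. indicator (D \<inter> A) y * (\<integral>\<^sup>+ t. indicator {0<..} t * (ennreal (J t y) * \<phi> (s t y)) \<partial>lborel) \<partial>lborel)
    = (\<integral>\<^sup>+ t. indicator {0<..} t * (\<integral>\<^sup>+ z. indicator E z * (indicator (B t) z * \<phi> z) \<partial>lborel) \<partial>lborel)"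
proof -
  have [measurable]: "(\<lambda>x. s (f x) (g x)) \<in> borel_measurable N" "(\<lambda>x. J (f x) (g x)) \<in> borel_measurable N"
    if [measurable]: "f \<in> borel_measurable N" "g \<in> borel_measurable N" for f g and N :: "'z measure"
    using measurable_compose[OF _ s_measurable, of "\<lambda>x. (f x, g x)" N]
      measurable_compose[OF _ J_measurable, of "\<lambda>x. (f x, g x)" N] by simp_all
  have B[measurable]: "Measurable.pred N (\<lambda>x. g x \<in> B (f x))"
    if [measurable]: "f \<in> borel_measurable N" "g \<in> borel_measurable N" for f g and N :: "'z measure"
    using measurable_compose[OF _ assms(3), of "\<lambda>x. (f x, g x)" N] by simp
  have "(\<integral>\<^sup>+ y. indicator (D \<inter> A) y * (\<integral>\<^sup>+ t. indicator {0<..} t * (ennreal (J t y) * \<phi> (s t y)) \<partial>lborel) \<partial>lborel)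
      = (\<integral>\<^sup>+ y. \<integral>\<^sup>+ t. indicator (D \<inter> A) y * (indicator {0<..} t * (ennreal (J t y) * \<phi> (s t y))) \<partial>lborel \<partial>lborel)"
    by (intro nn_integral_cong) (simp add: nn_integral_cmult)
  also have "\<dots> = (\<integral>\<^sup>+ t. \<integral>\<^sup>+ y. indicator (D \<inter> A) y * (indicator {0<..} t * (ennreal (J t y) * \<phi> (s t y))) \<partial>lborel \<partial>lborel)"
    by (rule lborel_pair.Fubini') measurable
  also have "\<dots> = (\<integral>\<^sup>+ t. indicator {0<..} t * (\<integral>\<^sup>+ z. indicator E z * (indicator (B t) z * \<phi> z) \<partial>lborel) \<partial>lborel)"
  proof (intro nn_integral_cong)
    fix t :: real
    show "(\<integral>\<^sup>+ y. indicator (D \<inter> A) y * (indicator {0<..} t * (ennreal (J t y) * \<phi> (s t y))) \<partial>lborel)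
      = indicator {0<..} t * (\<integral>\<^sup>+ z. indicator E z * (indicator (B t) z * \<phi> z) \<partial>lborel)"
    proof (cases "0 < t")
      case True
      have "(\<integral>\<^sup>+ y. indicator (D \<inter> A) y * (indicator {0<..} t * (ennreal (J t y) * \<phi> (s t y))) \<partial>lborel)
        = (\<integral>\<^sup>+ y. indicator D y * ennreal (J t y) * (indicator (B t) (s t y) * \<phi> (s t y)) \<partial>lborel)"
        using True AB[OF True] by (intro nn_integral_cong) (auto split: split_indicator)
      also have "\<dots> = (\<integral>\<^sup>+ z. indicator E z * (indicator (B t) z * \<phi> z) \<partial>lborel)"
        by (rule substitution[OF True, of "\<lambda>z. indicator (B t) z * \<phi> z"]) measurable
      finally show ?thesis using True by simp
    qed simp
  qed
  finally show ?thesis .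
qed

text \<open>
  The integral over \<open>t > 0\<close> of the mass that the weight \<open>\<phi>\<close> on \<open>E\<close> gives to \<open>B t\<close>.
\<close>
definition scaled_mass :: "(real ^ 'd \<Rightarrow> real) \<Rightarrow> (real \<Rightarrow> (real ^ 'd) set) \<Rightarrow> ennreal" where
  "scaled_mass \<phi> B = (\<integral>\<^sup>+ t. indicator {0<..} t *
     (\<integral>\<^sup>+ z. indicator E z * (indicator (B t) z * ennreal (\<phi> z)) \<partial>lborel) \<partial>lborel)"

text \<open>
  The scheme for a general weight \<open>\<phi>\<close>. The inner integral defining \<open>h\<close> is a Bochner integral and takes
  the value 0 where it diverges; since the total mass \<open>c\<close> is finite, this happens only on a null set.
\<close>
lemma mixture_density:
  fixes \<phi> :: "real ^ 'd \<Rightarrow> real"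
  assumes [measurable]: "\<phi> \<in> borel_measurable borel" and \<phi>_nonneg: "\<And>z. 0 \<le> \<phi> z"
    and c: "scaled_mass \<phi> (\<lambda>t. {z. \<not> z \<le> s t 0}) = ennreal c" "0 < c"
    and h: "\<And>y. h y = (if y \<in> D \<and> \<not> y \<le> 0 then 1 / c * (LBINT t:{0<..}. J t y * \<phi> (s t y)) else 0)"
  shows "h \<in> borel_measurable borel" "\<And>y. 0 \<le> h y"
    "prob_space (density lborel (\<lambda>y. ennreal (h y)))"
    "\<And>x. x \<in> X \<Longrightarrow> measure (density lborel (\<lambda>y. ennreal (h y))) {..x}
        = enn2real (scaled_mass \<phi> (\<lambda>t. {z. z \<le> s t x \<and> \<not> z \<le> s t 0})) / c"
proof -
  have [measurable]: "(\<lambda>x. s (f x) (g x)) \<in> borel_measurable N" "(\<lambda>x. J (f x) (g x)) \<in> borel_measurable N"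
    if [measurable]: "f \<in> borel_measurable N" "g \<in> borel_measurable N" for f g and N :: "'z measure"
    using measurable_compose[OF _ s_measurable, of "\<lambda>x. (f x, g x)" N]
      measurable_compose[OF _ J_measurable, of "\<lambda>x. (f x, g x)" N] by simp_all
  define k where "k y = (\<integral>\<^sup>+ t. indicator {0<..} t * (ennreal (J t y) * ennreal (\<phi> (s t y))) \<partial>lborel)" for y
  have [measurable]: "k \<in> borel_measurable borel" unfolding k_def by measurable
  have hk: "h y = indicator (D \<inter> {y. \<not> y \<le> 0}) y * (enn2real (k y) / c)" for y
  proof (cases "y \<in> D \<and> \<not> y \<le> 0")
    case True
    have "(LBINT t:{0<..}. J t y * \<phi> (s t y)) = enn2real (\<integral>\<^sup>+ t. ennreal (indicator {0<..} t *\<^sub>R (J t y * \<phi> (s t y))) \<partial>lborel)"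
      unfolding set_lebesgue_integral_def
      by (rule integral_eq_nn_integral) (use True in \<open>auto simp: J_nonneg \<phi>_nonneg split: split_indicator\<close>)
    also have "\<dots> = enn2real (k y)"
      unfolding k_def using True
      by (intro arg_cong[where f = enn2real] nn_integral_cong)
        (auto simp: J_nonneg \<phi>_nonneg ennreal_mult split: split_indicator)
    finally show ?thesis using True by (simp add: h)
  qed (auto simp: h)
  show h_meas[measurable]: "h \<in> borel_measurable borel" unfolding hk by measurable
  show h_nonneg: "0 \<le> h y" for y using c(2) by (auto simp: hk split: split_indicator)
  have mass: "(\<integral>\<^sup>+ y. indicator (D \<inter> A) y * k y \<partial>lborel) = scaled_mass \<phi> B"
    if "A \<in> sets borel" "Measurable.pred (borel \<Otimes>\<^sub>M borel) (\<lambda>(t, z). z \<in> B t)"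
      "\<And>t y. 0 < t \<Longrightarrow> y \<in> D \<Longrightarrow> y \<in> A \<longleftrightarrow> s t y \<in> B t" for A B
    using Fubini_scaling[of "\<lambda>z. ennreal (\<phi> z)", OF _ that] by (simp add: k_def scaled_mass_def)
  have total: "(\<integral>\<^sup>+ y. indicator (D \<inter> {y. \<not> y \<le> 0}) y * k y \<partial>lborel) = ennreal c"
    unfolding c(1)[symmetric]
    by (rule mass) (auto simp: s_le_iff[OF _ zero_in_X])
  have "AE y in lborel. indicator (D \<inter> {y. \<not> y \<le> 0}) y * k y \<noteq> \<infinity>"
    by (rule nn_integral_noteq_infinite) (auto simp: total)
  then have AE_h: "AE y in lborel. ennreal (h y) = indicator (D \<inter> {y. \<not> y \<le> 0}) y * k y / ennreal c"
  proof eventually_elim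
    case (elim y)
    show ?case
    proof (cases "y \<in> D \<and> \<not> y \<le> 0")
      case True
      then have "k y < \<infinity>" using elim by (auto simp: less_top)
      then have "ennreal (enn2real (k y) / c) = k y / ennreal c"
        using c(2) by (simp add: divide_ennreal[symmetric])
      then show ?thesis using True by (simp add: hk)
    qed (auto simp: hk)
  qed
  have int: "emeasure (density lborel (\<lambda>y. ennreal (h y))) A
      = (\<integral>\<^sup>+ y. indicator (D \<inter> (A \<inter> {y. \<not> y \<le> 0})) y * k y \<partial>lborel) / ennreal c" if [measurable]: "A \<in> sets borel" for A
  proof -
    have "emeasure (density lborel (\<lambda>y. ennreal (h y))) A = (\<integral>\<^sup>+ y. ennreal (h y) * indicator A y \<partial>lborel)"
      by (simp add: emeasure_density)
    also have "\<dots> = (\<integral>\<^sup>+ y. (indicator (D \<inter> (A \<inter> {y. \<not> y \<le> 0})) y * k y) / ennreal c \<partial>lborel)"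
      by (rule nn_integral_cong_AE, use AE_h in eventually_elim) (auto split: split_indicator)
    also have "\<dots> = (\<integral>\<^sup>+ y. indicator (D \<inter> (A \<inter> {y. \<not> y \<le> 0})) y * k y \<partial>lborel) / ennreal c"
      by (rule nn_integral_divide) measurable
    finally show ?thesis .
  qed
  show "prob_space (density lborel (\<lambda>y. ennreal (h y)))"
    by (rule prob_spaceI) (use int[of UNIV] total c(2) in \<open>simp add: divide_ennreal\<close>)
  fix x assume x: "x \<in> X"
  have "(\<integral>\<^sup>+ y. indicator (D \<inter> ({..x} \<inter> {y. \<not> y \<le> 0})) y * k y \<partial>lborel)
      = scaled_mass \<phi> (\<lambda>t. {z. z \<le> s t x \<and> \<not> z \<le> s t 0})"
    by (rule mass) (auto simp: s_le_iff[OF _ zero_in_X] s_le_iff[OF _ x])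
  then show "measure (density lborel (\<lambda>y. ennreal (h y))) {..x}
        = enn2real (scaled_mass \<phi> (\<lambda>t. {z. z \<le> s t x \<and> \<not> z \<le> s t 0})) / c"
    using int[of "{..x}"] c(2)
    by (simp add: measure_def divide_ennreal_def enn2real_mult inverse_ennreal divide_inverse)
qed

text \<open>
  If \<open>z \<le> s t 0\<close> means that \<open>t\<close> dominates all \<open>V j z\<close>, then the total mass is the integral of the
  maximum of the \<open>V j\<close> (the layer-cake formula).
\<close>
lemma scaled_mass_total:
  fixes V :: "'d \<Rightarrow> real ^ 'd \<Rightarrow> real"
  assumes [measurable]: "\<phi> \<in> borel_measurable borel" "\<And>j. V j \<in> borel_measurable borel"
    and V: "\<And>t z. 0 < t \<Longrightarrow> z \<in> E \<Longrightarrow> z \<le> s t 0 \<longleftrightarrow> (\<forall>j. V j z \<le> t)"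
    and V_nonneg: "\<And>j z. z \<in> E \<Longrightarrow> 0 \<le> V j z"
  shows "scaled_mass \<phi> (\<lambda>t. {z. \<not> z \<le> s t 0})
    = (\<integral>\<^sup>+ z. indicator E z * (ennreal (\<phi> z) * ennreal (Max (range (\<lambda>j. V j z)))) \<partial>lborel)"
proof -
  have "scaled_mass \<phi> (\<lambda>t. {z. \<not> z \<le> s t 0})
      = (\<integral>\<^sup>+ t. \<integral>\<^sup>+ z. indicator {0<..} t * (indicator E z * (of_bool (\<exists>j. t < V j z) * ennreal (\<phi> z))) \<partial>lborel \<partial>lborel)"
    unfolding scaled_mass_def
  proof (intro nn_integral_cong)
    fix t :: real
    have "indicator {0<..} t * (\<integral>\<^sup>+ z. indicator E z * (indicator {z. \<not> z \<le> s t 0} z * ennreal (\<phi> z)) \<partial>lborel)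
        = indicator {0<..} t * (\<integral>\<^sup>+ z. indicator E z * (of_bool (\<exists>j. t < V j z) * ennreal (\<phi> z)) \<partial>lborel)"
    proof (cases "0 < t")
      case True
      have "(\<integral>\<^sup>+ z. indicator E z * (indicator {z. \<not> z \<le> s t 0} z * ennreal (\<phi> z)) \<partial>lborel)
          = (\<integral>\<^sup>+ z. indicator E z * (of_bool (\<exists>j. t < V j z) * ennreal (\<phi> z)) \<partial>lborel)"
        using V[OF True] by (intro nn_integral_cong) (auto simp: not_le split: split_indicator)
      then show ?thesis by simp
    qed simp
    then show "indicator {0<..} t * (\<integral>\<^sup>+ z. indicator E z * (indicator {z. \<not> z \<le> s t 0} z * ennreal (\<phi> z)) \<partial>lborel)
        = (\<integral>\<^sup>+ z. indicator {0<..} t * (indicator E z * (of_bool (\<exists>j. t < V j z) * ennreal (\<phi> z))) \<partial>lborel)"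
      by (simp add: nn_integral_cmult)
  qed
  also have "\<dots> = (\<integral>\<^sup>+ z. \<integral>\<^sup>+ t. indicator {0<..} t * (indicator E z * (of_bool (\<exists>j. t < V j z) * ennreal (\<phi> z))) \<partial>lborel \<partial>lborel)"
    by (rule lborel_pair.Fubini') measurable
  also have "\<dots> = (\<integral>\<^sup>+ z. indicator E z * (ennreal (\<phi> z) * ennreal (Max (range (\<lambda>j. V j z)))) \<partial>lborel)"
  proof (intro nn_integral_cong)
    fix z
    show "(\<integral>\<^sup>+ t. indicator {0<..} t * (indicator E z * (of_bool (\<exists>j. t < V j z) * ennreal (\<phi> z))) \<partial>lborel)
        = indicator E z * (ennreal (\<phi> z) * ennreal (Max (range (\<lambda>j. V j z))))"
    proof (cases "z \<in> E")
      case True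
      have "(\<integral>\<^sup>+ t. indicator {0<..} t * (indicator E z * (of_bool (\<exists>j. t < V j z) * ennreal (\<phi> z))) \<partial>lborel)
          = (\<integral>\<^sup>+ t. ennreal (\<phi> z) * indicator {0<..<Max (range (\<lambda>j. V j z))} t \<partial>lborel)"
        using True by (intro nn_integral_cong) (auto simp: Max_gr_iff split: split_indicator)
      also have "0 \<le> Max (range (\<lambda>j. V j z))"
        using V_nonneg[OF True] by (auto simp: Max_ge_iff)
      then have "(\<integral>\<^sup>+ t. ennreal (\<phi> z) * indicator {0<..<Max (range (\<lambda>j. V j z))} t \<partial>lborel)
          = ennreal (\<phi> z) * ennreal (Max (range (\<lambda>j. V j z)))"
        by (simp add: nn_integral_cmult_indicator)
      finally show ?thesis using True by simp
    qed simp
  qed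
  finally show ?thesis .
qed

lemma set_integral_measure_eq_scaled_mass:
  assumes f: "has_density F f" and E: "AE z in density lborel (\<lambda>y. ennreal (f y)). z \<in> E"
    and B[measurable]: "Measurable.pred (borel \<Otimes>\<^sub>M borel) (\<lambda>(t, z). z \<in> B t)"
  shows "(LBINT t:{0<..}. measure (density lborel (\<lambda>y. ennreal (f y))) (B t)) = enn2real (scaled_mass f B)"
proof -
  define P where "P = density lborel (\<lambda>y. ennreal (f y))"
  interpret P: prob_space P using has_densityD(3)[OF f] by (simp add: P_def)
  note [measurable] = has_densityD(1)[OF f]
  have [measurable]: "Measurable.pred borel (\<lambda>z. z \<in> B t)" for t
    using measurable_compose[OF _ B, of "\<lambda>z. (t, z)" borel] by simp
  then have Bt: "B t \<in> sets borel" for t by (simp add: pred_def)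
  have [measurable]: "Measurable.pred (borel \<Otimes>\<^sub>M borel) (\<lambda>x. snd x \<in> B (fst x))"
    using B by (simp add: case_prod_unfold)
  define m where "m t = (\<integral>\<^sup>+ z. indicator E z * (indicator (B t) z * ennreal (f z)) \<partial>lborel)" for t
  have [measurable]: "m \<in> borel_measurable borel" unfolding m_def by measurable
  have m: "m t = emeasure P (B t)" for t
  proof -
    have "AE z in lborel. 0 < f z \<longrightarrow> z \<in> E"
      using E by (subst (asm) AE_density) auto
    then have "m t = (\<integral>\<^sup>+ z. ennreal (f z) * indicator (B t) z \<partial>lborel)"
      unfolding m_def using has_densityD(2)[OF f]
      by (intro nn_integral_cong_AE) (auto elim!: eventually_mono split: split_indicator simp: order.order_iff_strict)
    then show ?thesis using Bt by (simp add: P_def emeasure_density)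
  qed
  have "(LBINT t:{0<..}. measure P (B t)) = enn2real (\<integral>\<^sup>+ t. ennreal (indicator {0<..} t *\<^sub>R enn2real (m t)) \<partial>lborel)"
    unfolding set_lebesgue_integral_def measure_def m[symmetric]
    by (rule integral_eq_nn_integral) auto
  also have "(\<integral>\<^sup>+ t. ennreal (indicator {0<..} t *\<^sub>R enn2real (m t)) \<partial>lborel) = scaled_mass f B"
    unfolding scaled_mass_def m_def[symmetric]
    by (intro nn_integral_cong) (auto simp: m P.emeasure_eq_measure split: split_indicator)
  finally show ?thesis by (simp add: P_def)
qed

text \<open>
  The scheme when the weight is a probability density \<open>f\<close> with distribution function \<open>F\<close>, in the form
  common to \<open>H\<^sub>R\<close> and \<open>H\<^sub>U\<close>. The constant \<open>c F\<close> is positive and finite, being the mean of the maximum of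
  the positive integrable functions \<open>V j\<close>.
\<close>
lemma normalised_mixture_density:
  fixes V :: "'d \<Rightarrow> real ^ 'd \<Rightarrow> real"
  defines "c F \<equiv> LBINT t:{0<..}. 1 - F (s t 0)"
  assumes f: "has_density F f" and E: "AE z in density lborel (\<lambda>y. ennreal (f y)). z \<in> E"
    and [measurable]: "\<And>j. V j \<in> borel_measurable borel"
    and V: "\<And>t z. 0 < t \<Longrightarrow> z \<in> E \<Longrightarrow> z \<le> s t 0 \<longleftrightarrow> (\<forall>j. V j z \<le> t)"
    and V_pos: "\<And>j z. z \<in> E \<Longrightarrow> 0 < V j z"
    and V_fin: "\<And>j. (\<integral>\<^sup>+ z. ennreal (V j z) \<partial>density lborel (\<lambda>y. ennreal (f y))) < \<infinity>"
    and h: "\<And>y. h y = (if y \<in> D \<and> \<not> y \<le> 0 then 1 / c F * (LBINT t:{0<..}. J t y * f (s t y)) else 0)"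
  shows "h \<in> borel_measurable borel" "\<And>y. 0 \<le> h y"
    "prob_space (density lborel (\<lambda>y. ennreal (h y)))"
    "\<And>x. x \<in> X \<Longrightarrow> (LBINT t:{0<..}. F (s t x) - F (s t (neg_part_vec x))) / c F
        = measure (density lborel (\<lambda>y. ennreal (h y))) {..x}"
proof -
  define P where "P = density lborel (\<lambda>y. ennreal (f y))"
  interpret P: prob_space P using has_densityD(3)[OF f] by (simp add: P_def)
  have [measurable_cong]: "sets P = sets borel" and [simp]: "space P = UNIV" by (simp_all add: P_def)
  note f_meas[measurable] = has_densityD(1)[OF f] and f_nonneg = has_densityD(2)[OF f]
  have F: "F x = measure P {..x}" for x using has_densityD(4)[OF f] by (simp add: P_def)
  have [measurable]: "(\<lambda>x. s (fst x) (g x)) \<in> borel_measurable (borel \<Otimes>\<^sub>M borel)"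
    if [measurable]: "g \<in> borel_measurable (borel \<Otimes>\<^sub>M borel)" for g :: "real \<times> (real ^ 'd) \<Rightarrow> real ^ 'd"
    using measurable_compose[OF _ s_measurable, of "\<lambda>x. (fst x, g x)" "borel \<Otimes>\<^sub>M borel"] by simp
  let ?B = "\<lambda>t. {z. \<not> z \<le> s t 0}"
  let ?M = "\<lambda>z. Max (range (\<lambda>j. V j z))"
  have M_pos: "0 < ?M z" if "z \<in> E" for z
    using V_pos[OF that] by (auto simp: Max_gr_iff)
  have mass: "scaled_mass f ?B = (\<integral>\<^sup>+ z. indicator E z * (ennreal (f z) * ennreal (?M z)) \<partial>lborel)"
    by (rule scaled_mass_total) (auto simp: V less_imp_le[OF V_pos])
  have "scaled_mass f ?B \<le> (\<integral>\<^sup>+ z. (\<Sum>j\<in>UNIV. ennreal (f z) * ennreal (V j z)) \<partial>lborel)"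
    unfolding mass
  proof (rule nn_integral_mono)
    fix z
    show "indicator E z * (ennreal (f z) * ennreal (?M z)) \<le> (\<Sum>j\<in>UNIV. ennreal (f z) * ennreal (V j z))"
    proof (cases "z \<in> E")
      case True
      have "?M z \<in> range (\<lambda>j. V j z)" by (rule Max_in) auto
      then obtain j where "?M z = V j z" by (rule rangeE)
      then have "ennreal (f z) * ennreal (?M z) \<le> (\<Sum>j\<in>UNIV. ennreal (f z) * ennreal (V j z))"
        by (simp add: member_le_sum[of j UNIV "\<lambda>j. ennreal (f z) * ennreal (V j z)"])
      then show ?thesis by (simp add: True)
    qed simp
  qed
  also have "\<dots> = (\<Sum>j\<in>UNIV. \<integral>\<^sup>+ z. ennreal (V j z) \<partial>P)"
    by (simp add: nn_integral_sum P_def nn_integral_density)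
  also have "\<dots> < \<infinity>" using V_fin by (simp add: P_def ennreal_sum_less_top)
  finally have fin: "scaled_mass f ?B < \<infinity>" .
  have pos: "scaled_mass f ?B \<noteq> 0"
  proof
    assume "scaled_mass f ?B = 0"
    then have "AE z in lborel. indicator E z * (ennreal (f z) * ennreal (?M z)) = 0"
      unfolding mass by (subst (asm) nn_integral_0_iff_AE) auto
    then have "AE z in lborel. 0 < f z \<longrightarrow> z \<notin> E"
    proof eventually_elim
      case (elim z)
      then show ?case using M_pos[of z]
        by (auto simp: ennreal_eq_0_iff not_le[symmetric] simp del: Max_le_iff split: split_indicator_asm)
    qed
    then have "AE z in P. z \<notin> E" unfolding P_def by (subst AE_density) auto
    moreover have "AE z in P. z \<in> E" unfolding P_def by (rule E)
    ultimately have "AE z in P. False" by eventually_elim simp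
    then show False by simp
  qed
  have "c F = (LBINT t:{0<..}. measure P (?B t))"
    unfolding c_def
  proof (rule set_lebesgue_integral_cong)
    show "\<forall>t. t \<in> {0<..} \<longrightarrow> 1 - F (s t 0) = measure P (?B t)"
    proof (intro allI impI)
      fix t
      have "{z. \<not> z \<le> s t 0} = space P - {..s t 0}" by auto
      then show "1 - F (s t 0) = measure P (?B t)"
        by (simp only: F) (subst P.prob_compl, auto)
    qed
  qed simp
  also have "\<dots> = enn2real (scaled_mass f ?B)"
    unfolding P_def by (rule set_integral_measure_eq_scaled_mass[OF f E]) (simp add: case_prod_unfold)
  finally have c: "c F = enn2real (scaled_mass f ?B)" .
  have c1: "scaled_mass f ?B = ennreal (c F)" "0 < c F"
    using fin pos by (simp_all add: c enn2real_positive_iff zero_less_iff_neq_zero)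
  note md = mixture_density[OF f_meas f_nonneg c1 h]
  show "h \<in> borel_measurable borel" "\<And>y. 0 \<le> h y" "prob_space (density lborel (\<lambda>y. ennreal (h y)))"
    by (fact md)+
  fix x assume x: "x \<in> X"
  have "(LBINT t:{0<..}. F (s t x) - F (s t (neg_part_vec x)))
      = (LBINT t:{0<..}. measure P {z. z \<le> s t x \<and> \<not> z \<le> s t 0})"
  proof (rule set_lebesgue_integral_cong)
    show "\<forall>t. t \<in> {0<..} \<longrightarrow> F (s t x) - F (s t (neg_part_vec x)) = measure P {z. z \<le> s t x \<and> \<not> z \<le> s t 0}"
    proof (intro allI impI)
      fix t :: real assume "t \<in> {0<..}"
      then have "{z. z \<le> s t x \<and> \<not> z \<le> s t 0} = {..s t x} - {..s t (neg_part_vec x)}"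
        "{..s t (neg_part_vec x)} \<subseteq> {..s t x}"
        using le_s_neg_part_iff[OF _ x, of t] by auto
      then show "F (s t x) - F (s t (neg_part_vec x)) = measure P {z. z \<le> s t x \<and> \<not> z \<le> s t 0}"
        by (simp only: F) (subst P.finite_measure_Diff, auto)
    qed
  qed simp
  also have "\<dots> = enn2real (scaled_mass f (\<lambda>t. {z. z \<le> s t x \<and> \<not> z \<le> s t 0}))"
    unfolding P_def by (rule set_integral_measure_eq_scaled_mass[OF f E]) (simp add: case_prod_unfold)
  finally show "(LBINT t:{0<..}. F (s t x) - F (s t (neg_part_vec x))) / c F
        = measure (density lborel (\<lambda>y. ennreal (h y))) {..x}"
    using md(4)[OF x] by simp
qed

end

section \<open>The two scaling families\<close>

text \<open>
  A component of the map \<open>gp_std\<close>, with \<open>p\<close>, \<open>q\<close> in place of \<open>\<gamma>\<^sub>j\<close>, \<open>\<sigma>\<^sub>j\<close>, and its inverse. The map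
  is an increasing bijection from the half-line \<open>p s + q > 0\<close> onto the real line.
\<close>
definition std1 :: "real \<Rightarrow> real \<Rightarrow> real \<Rightarrow> real" where
  "std1 p q s = (if p = 0 then s / q else 1 / p * ln (p / q * s + 1))"

definition std1_inv :: "real \<Rightarrow> real \<Rightarrow> real \<Rightarrow> real" where
  "std1_inv p q y = (if p = 0 then q * y else q / p * (exp (p * y) - 1))"

lemma std1_std1_inv: "0 < q \<Longrightarrow> std1 p q (std1_inv p q y) = y"
  by (simp add: std1_def std1_inv_def)

lemma std1_inv_pos: "0 < q \<Longrightarrow> 0 < p * std1_inv p q y + q"
  by (simp add: std1_inv_def algebra_simps)

lemma std1_arg_pos:
  fixes p q s :: real
  assumes "0 < q" "0 < p * s + q"
  shows "0 < p / q * s + 1"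
proof -
  have "p / q * s + 1 = (p * s + q) / q" using assms(1) by (simp add: add_divide_distrib)
  then show ?thesis using assms by simp
qed

lemma std1_inv_std1:
  assumes "0 < q" "0 < p * s + q"
  shows "std1_inv p q (std1 p q s) = s"
  using assms std1_arg_pos[OF assms] by (simp add: std1_def std1_inv_def)

lemma std1_inv_le_iff: "0 < q \<Longrightarrow> std1_inv p q x \<le> std1_inv p q y \<longleftrightarrow> x \<le> y"
proof (cases p "0 :: real" rule: linorder_cases)
  case less
  assume "0 < q"
  with less have "q / p < 0" by (simp add: divide_pos_neg)
  then show ?thesis using less by (simp add: std1_inv_def mult_le_cancel_left_neg del: times_divide_eq_left)
next
  case greater
  assume "0 < q"
  with greater have "0 < q / p" by simp
  then show ?thesis using greater by (simp add: std1_inv_def mult_le_cancel_left_pos del: times_divide_eq_left)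
qed (simp add: std1_inv_def)

lemma std1_le_iff:
  assumes "0 < q" "0 < p * s + q"
  shows "std1 p q s \<le> y \<longleftrightarrow> s \<le> std1_inv p q y" "y \<le> std1 p q s \<longleftrightarrow> std1_inv p q y \<le> s"
  using std1_inv_le_iff[OF assms(1), of p "std1 p q s" y] std1_inv_le_iff[OF assms(1), of p y "std1 p q s"]
  by (simp_all add: std1_inv_std1 assms)

lemma std1_mono_iff:
  assumes "0 < q" "0 < p * x + q" "0 < p * y + q"
  shows "std1 p q x \<le> std1 p q y \<longleftrightarrow> x \<le> y"
  by (simp add: std1_le_iff(1) std1_inv_std1 assms)

lemma DERIV_std1:
  fixes p q s :: real
  assumes "0 < q" "0 < p * s + q"
  shows "(std1 p q has_real_derivative inverse (p * s + q)) (at s)"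
proof (cases "p = 0")
  case True
  then show ?thesis using assms unfolding std1_def by (auto intro!: derivative_eq_intros simp: field_simps)
next
  case False
  have eq: "p / q * s + 1 = (p * s + q) / q" using assms(1) by (simp add: add_divide_distrib)
  have "((\<lambda>s. 1 / p * ln (p / q * s + 1)) has_real_derivative 1 / p * (p / q / (p / q * s + 1))) (at s)"
    using std1_arg_pos[OF assms] less_imp_neq[OF assms(1)] by (auto intro!: derivative_eq_intros)
  also have "1 / p * (p / q / (p / q * s + 1)) = inverse (p * s + q)"
    unfolding eq using less_imp_neq[OF assms(1)] False by (auto simp: divide_inverse)
  finally have "((\<lambda>s. 1 / p * ln (p / q * s + 1)) has_real_derivative inverse (p * s + q)) (at s)" .
  then show ?thesis using False by (simp add: std1_def[abs_def])
qed

lemma std1_measurable [measurable]: "std1 p q \<in> borel_measurable borel"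
  unfolding std1_def by measurable

text \<open>
  The derivative of \<open>std1 p q\<close> is \<open>1 / (p s + q)\<close>, so this is the fundamental theorem of calculus on
  the preimage of an interval.
\<close>
lemma nn_integral_std1_substitution:
  assumes q: "0 < q" and "a \<le> b"
  shows "(\<integral>\<^sup>+ s. indicator {s. 0 < p * s + q} s * ennreal (inverse (p * s + q)) * indicator {a<..<b} (std1 p q s + c) \<partial>lborel)
    = ennreal (b - a)"
proof -
  define A B where "A = std1_inv p q (a - c)" and "B = std1_inv p q (b - c)"
  have AB: "A \<le> B" using assms by (simp add: A_def B_def std1_inv_le_iff)
  have pos: "0 < p * s + q" if "A \<le> s" "s \<le> B" for s
  proof (cases "0 \<le> p")
    case True
    then have "p * A \<le> p * s" using that by (intro mult_left_mono)
    with std1_inv_pos[OF q, of p "a - c"] show ?thesis by (simp add: A_def)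
  next
    case False
    then have "p * B \<le> p * s" using that by (intro mult_left_mono_neg) auto
    with std1_inv_pos[OF q, of p "b - c"] show ?thesis by (simp add: B_def)
  qed
  have "(\<integral>\<^sup>+ s. indicator {s. 0 < p * s + q} s * ennreal (inverse (p * s + q)) * indicator {a<..<b} (std1 p q s + c) \<partial>lborel)
      = (\<integral>\<^sup>+ s. ennreal (inverse (p * s + q)) * indicator {A..B} s \<partial>lborel)"
  proof (rule nn_integral_cong_AE)
    show "AE s in lborel. indicator {s. 0 < p * s + q} s * ennreal (inverse (p * s + q)) * indicator {a<..<b} (std1 p q s + c)
        = ennreal (inverse (p * s + q)) * indicator {A..B} s"
      using AE_lborel_singleton[of A] AE_lborel_singleton[of B]
    proof eventually_elim
      case (elim s)
      show ?case
      proof (cases "0 < p * s + q")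
        case True
        have "a < std1 p q s + c \<longleftrightarrow> A < s" "std1 p q s + c < b \<longleftrightarrow> s < B"
          using std1_le_iff(1)[OF q True, of "a - c"] std1_le_iff(2)[OF q True, of "b - c"]
          by (auto simp: A_def B_def not_le[symmetric] le_diff_eq diff_le_eq)
        then show ?thesis using True elim by (auto split: split_indicator)
      next
        case False
        then have "s \<notin> {A..B}" using pos[of s] by auto
        then show ?thesis using False by simp
      qed
    qed
  qed
  also have "\<dots> = ennreal (std1 p q B - std1 p q A)"
    by (rule nn_integral_FTC_Icc) (use AB pos q in \<open>auto intro!: DERIV_std1 DERIV_subset[OF DERIV_std1] less_imp_le\<close>)
  also have "\<dots> = ennreal (b - a)" using q by (simp add: A_def B_def std1_std1_inv)
  finally show ?thesis .
qed

lemma gp_std_eq: "gp_std \<gamma> \<sigma> x = (\<chi> j. std1 (\<gamma> $ j) (\<sigma> $ j) (x $ j))"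
  by (simp add: gp_std_def std1_def)

lemma gp_domain_sets [measurable]: "gp_domain \<gamma> \<sigma> \<in> sets borel"
  unfolding gp_domain_def by measurable

lemma zero_in_gp_domain: "(\<And>j. 0 < \<sigma> $ j) \<Longrightarrow> 0 \<in> gp_domain \<gamma> \<sigma>"
  by (simp add: gp_domain_def)

lemma scaling_family_std:
  fixes \<gamma> \<sigma> :: "real ^ 'd::finite"
  assumes \<sigma>: "\<And>j. 0 < \<sigma> $ j"
  shows "scaling_family (gp_domain \<gamma> \<sigma>) (gp_domain \<gamma> \<sigma>) UNIV
    (\<lambda>t y. add_scalar (gp_std \<gamma> \<sigma> y) (ln t)) (\<lambda>t y. \<Prod>j\<in>UNIV. inverse (\<gamma> $ j * y $ j + \<sigma> $ j))"
proof
  show "(\<lambda>(t, y). add_scalar (gp_std \<gamma> \<sigma> y) (ln t)) \<in> borel_measurable (borel \<Otimes>\<^sub>M borel)"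
    unfolding add_scalar_def gp_std_eq by measurable
  show "(\<lambda>(t::real, y). \<Prod>j\<in>UNIV. inverse (\<gamma> $ j * y $ j + \<sigma> $ j)) \<in> borel_measurable (borel \<Otimes>\<^sub>M borel)"
    by measurable
  show "0 \<le> (\<Prod>j\<in>UNIV. inverse (\<gamma> $ j * y $ j + \<sigma> $ j))" if "y \<in> gp_domain \<gamma> \<sigma>" for y
    using that by (intro prod_nonneg) (auto simp: gp_domain_def less_imp_le)
  show "add_scalar (gp_std \<gamma> \<sigma> y) (ln t) \<le> add_scalar (gp_std \<gamma> \<sigma> x) (ln t) \<longleftrightarrow> y \<le> x"
    if "x \<in> gp_domain \<gamma> \<sigma>" "y \<in> gp_domain \<gamma> \<sigma>" for t x y
    using that by (auto simp: add_scalar_def gp_std_eq less_eq_vec_def gp_domain_def std1_le_iff(1) std1_inv_std1 \<sigma>)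
  show "0 \<in> gp_domain \<gamma> \<sigma>" by (rule zero_in_gp_domain) (rule \<sigma>)
  show "z \<le> add_scalar (gp_std \<gamma> \<sigma> (neg_part_vec x)) (ln t) \<longleftrightarrow>
      z \<le> add_scalar (gp_std \<gamma> \<sigma> x) (ln t) \<and> z \<le> add_scalar (gp_std \<gamma> \<sigma> 0) (ln t)"
    if "x \<in> gp_domain \<gamma> \<sigma>" for t x z
  proof -
    have "std1 (\<gamma> $ j) (\<sigma> $ j) (min (x $ j) 0) = min (std1 (\<gamma> $ j) (\<sigma> $ j) (x $ j)) (std1 (\<gamma> $ j) (\<sigma> $ j) 0)" for j
      using that std1_mono_iff[OF \<sigma>, of "\<gamma> $ j" "x $ j" j 0] \<sigma>[of j]
      by (auto simp: min_def gp_domain_def)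
    then show ?thesis
      by (auto simp: add_scalar_def gp_std_eq neg_part_vec_def less_eq_vec_def diff_le_eq[symmetric])
  qed
  fix t :: real and g :: "real ^ 'd \<Rightarrow> ennreal" assume [measurable]: "g \<in> borel_measurable borel"
  let ?w = "\<lambda>j s. indicator {s. 0 < \<gamma> $ j * s + \<sigma> $ j} s * ennreal (inverse (\<gamma> $ j * s + \<sigma> $ j))"
  have w: "indicator (gp_domain \<gamma> \<sigma>) y * ennreal (\<Prod>j\<in>UNIV. inverse (\<gamma> $ j * y $ j + \<sigma> $ j))
      = (\<Prod>j\<in>UNIV. ?w j (y $ j))" for y
  proof (cases "y \<in> gp_domain \<gamma> \<sigma>")
    case True
    then show ?thesis by (simp add: gp_domain_def prod_ennreal less_imp_le)
  next
    case False
    then obtain j where "\<not> 0 < \<gamma> $ j * y $ j + \<sigma> $ j" by (auto simp: gp_domain_def)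
    then have "?w j (y $ j) = 0" by simp
    then have "(\<Prod>j\<in>UNIV. ?w j (y $ j)) = 0" by (intro prod_zero bexI[of _ j]) auto
    then show ?thesis using False by simp
  qed
  have "(\<integral>\<^sup>+ y. (\<Prod>j\<in>UNIV. ?w j (y $ j)) * g (\<chi> j. std1 (\<gamma> $ j) (\<sigma> $ j) (y $ j) + ln t) \<partial>lborel) = (\<integral>\<^sup>+ z. g z \<partial>lborel)"
    by (rule nn_integral_componentwise_substitution) (auto intro!: nn_integral_std1_substitution \<sigma>)
  then show "(\<integral>\<^sup>+ y. indicator (gp_domain \<gamma> \<sigma>) y * ennreal (\<Prod>j\<in>UNIV. inverse (\<gamma> $ j * y $ j + \<sigma> $ j))
      * g (add_scalar (gp_std \<gamma> \<sigma> y) (ln t)) \<partial>lborel) = (\<integral>\<^sup>+ z. indicator UNIV z * g z \<partial>lborel)"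
    by (simp add: w add_scalar_def gp_std_eq)
qed auto

text \<open>
  The image of the domain under every \<open>gp_scale \<gamma> \<sigma> t\<close>, \<open>t > 0\<close>; it also carries the law of \<open>R\<close>.
\<close>
definition sign_cone :: "real ^ 'd::finite \<Rightarrow> (real ^ 'd) set" where
  "sign_cone \<gamma> = {z. \<forall>j. (0 < \<gamma> $ j \<longrightarrow> 0 < z $ j) \<and> (\<gamma> $ j < 0 \<longrightarrow> z $ j < 0)}"

lemma nn_integral_affine_Ioo:
  assumes "0 < c" "a \<le> (b::real)"
  shows "(\<integral>\<^sup>+ s. ennreal c * indicator {a<..<b} (c * s + d) \<partial>lborel) = ennreal (b - a)"
proof -
  have "(\<integral>\<^sup>+ s. ennreal c * indicator {a<..<b} (c * s + d) \<partial>lborel)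
      = ennreal c * (\<integral>\<^sup>+ s. indicator {a<..<b} (d + c * s) \<partial>lborel)"
    by (simp add: nn_integral_cmult add.commute)
  also have "\<dots> = (\<integral>\<^sup>+ s. indicator {a<..<b} s \<partial>lborel)"
    using nn_integral_real_affine[of "indicator {a<..<b}" c d] assms by simp
  finally show ?thesis using assms by simp
qed

lemma gp_scale_in_sign_cone_iff:
  assumes "0 < t"
  shows "gp_scale \<gamma> \<sigma> t y \<in> sign_cone \<gamma> \<longleftrightarrow> (\<forall>j. \<gamma> $ j \<noteq> 0 \<longrightarrow> 0 < \<gamma> $ j * y $ j + \<sigma> $ j)"
proof -
  have "((0 < \<gamma> $ j \<longrightarrow> 0 < gp_scale \<gamma> \<sigma> t y $ j) \<and> (\<gamma> $ j < 0 \<longrightarrow> gp_scale \<gamma> \<sigma> t y $ j < 0))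
      \<longleftrightarrow> (\<gamma> $ j \<noteq> 0 \<longrightarrow> 0 < \<gamma> $ j * y $ j + \<sigma> $ j)" for j
  proof (cases "\<gamma> $ j = 0")
    case False
    then have "y $ j + \<sigma> $ j / \<gamma> $ j = (\<gamma> $ j * y $ j + \<sigma> $ j) / \<gamma> $ j" by (simp add: add_divide_distrib)
    then show ?thesis
      using assms False by (auto simp: gp_scale_def zero_less_mult_iff mult_less_0_iff zero_less_divide_iff divide_less_0_iff)
  qed simp
  then show ?thesis by (auto simp: sign_cone_def)
qed

lemma scaling_family_scale:
  fixes \<gamma> \<sigma> :: "real ^ 'd::finite"
  assumes \<sigma>: "\<And>j. 0 < \<sigma> $ j"
  shows "scaling_family (gp_domain \<gamma> \<sigma>) UNIV (sign_cone \<gamma>)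
    (gp_scale \<gamma> \<sigma>) (\<lambda>t y. t powr (\<Sum>j\<in>UNIV. \<gamma> $ j))"
proof
  show S[measurable]: "sign_cone \<gamma> \<in> sets borel" unfolding sign_cone_def by measurable
  show "(\<lambda>(t, y). gp_scale \<gamma> \<sigma> t y) \<in> borel_measurable (borel \<Otimes>\<^sub>M borel)"
    unfolding gp_scale_def by measurable
  fix t :: real assume t: "0 < t"
  show "gp_scale \<gamma> \<sigma> t y \<le> gp_scale \<gamma> \<sigma> t x \<longleftrightarrow> y \<le> x" for x y
    using t by (auto simp: gp_scale_def less_eq_vec_def)
  show "z \<le> gp_scale \<gamma> \<sigma> t (neg_part_vec x) \<longleftrightarrow> z \<le> gp_scale \<gamma> \<sigma> t x \<and> z \<le> gp_scale \<gamma> \<sigma> t 0" for x z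
  proof -
    have "gp_scale \<gamma> \<sigma> t (neg_part_vec x) $ j = min (gp_scale \<gamma> \<sigma> t x $ j) (gp_scale \<gamma> \<sigma> t 0 $ j)" for j
      using t by (auto simp: gp_scale_def neg_part_vec_def min_def distrib_left mult_le_0_iff)
    then show ?thesis by (auto simp: less_eq_vec_def)
  qed
  fix g :: "real ^ 'd \<Rightarrow> ennreal" assume [measurable]: "g \<in> borel_measurable borel"
  define d where "d j = (if \<gamma> $ j = 0 then \<sigma> $ j * ln t else t powr (\<gamma> $ j) * (\<sigma> $ j / \<gamma> $ j))" for j
  have sc: "gp_scale \<gamma> \<sigma> t y = (\<chi> j. t powr (\<gamma> $ j) * y $ j + d j)" for y
    using t by (auto simp: gp_scale_def d_def vec_eq_iff distrib_left)
  have "(\<integral>\<^sup>+ y. indicator (gp_domain \<gamma> \<sigma>) y * ennreal (t powr (\<Sum>j\<in>UNIV. \<gamma> $ j)) * g (gp_scale \<gamma> \<sigma> t y) \<partial>lborel)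
      = (\<integral>\<^sup>+ y. (\<Prod>j\<in>UNIV. ennreal (t powr (\<gamma> $ j))) *
          (indicator (sign_cone \<gamma>) (\<chi> j. t powr (\<gamma> $ j) * y $ j + d j) * g (\<chi> j. t powr (\<gamma> $ j) * y $ j + d j)) \<partial>lborel)"
  proof (intro nn_integral_cong)
    fix y
    have "y \<in> gp_domain \<gamma> \<sigma> \<longleftrightarrow> gp_scale \<gamma> \<sigma> t y \<in> sign_cone \<gamma>"
      unfolding gp_scale_in_sign_cone_iff[OF t] using \<sigma>
      by (auto simp: gp_domain_def) (metis \<sigma> add_0 mult_zero_left)
    then show "indicator (gp_domain \<gamma> \<sigma>) y * ennreal (t powr (\<Sum>j\<in>UNIV. \<gamma> $ j)) * g (gp_scale \<gamma> \<sigma> t y)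
      = (\<Prod>j\<in>UNIV. ennreal (t powr (\<gamma> $ j))) *
          (indicator (sign_cone \<gamma>) (\<chi> j. t powr (\<gamma> $ j) * y $ j + d j) * g (\<chi> j. t powr (\<gamma> $ j) * y $ j + d j))"
      using t by (simp add: sc[symmetric] prod_ennreal powr_sum indicator_def)
  qed
  also have "\<dots> = (\<integral>\<^sup>+ z. indicator (sign_cone \<gamma>) z * g z \<partial>lborel)"
    using nn_integral_componentwise_substitution[of "\<lambda>j s. ennreal (t powr (\<gamma> $ j))" "\<lambda>j s. t powr (\<gamma> $ j) * s + d j"
      "\<lambda>z. indicator (sign_cone \<gamma>) z * g z"] t
    by (simp add: nn_integral_affine_Ioo)
  finally show "(\<integral>\<^sup>+ y. indicator (gp_domain \<gamma> \<sigma>) y * ennreal (t powr (\<Sum>j\<in>UNIV. \<gamma> $ j)) * g (gp_scale \<gamma> \<sigma> t y) \<partial>lborel)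
      = (\<integral>\<^sup>+ z. indicator (sign_cone \<gamma>) z * g z \<partial>lborel)" .
qed auto

section \<open>Distribution functions specified on the domain\<close>

text \<open>
  A law with density \<open>h\<close> concentrated on the domain is the only one whose distribution function agrees
  with its own on the domain. Indeed the domain is an open box. Points \<open>e r\<close> of the domain
  increase to its upper corner as \<open>r\<close> tends to infinity, and decrease to its lower corner as \<open>r\<close> tends to
  minus infinity. Comparing the two laws along these points shows that any competitor \<open>Q\<close> is also
  concentrated on the domain, and then the values at arbitrary points follow by continuity from below.
\<close>
lemma has_density_the_cdf_on:
  fixes \<gamma> \<sigma> :: "real ^ 'd::finite"
  assumes \<sigma>: "\<And>j. 0 < \<sigma> $ j"
    and h: "h \<in> borel_measurable borel" "\<And>y. 0 \<le> h y"
      "prob_space (density lborel (\<lambda>y. ennreal (h y)))"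
    and h_zero: "\<And>y. y \<notin> gp_domain \<gamma> \<sigma> \<Longrightarrow> h y = 0"
    and G: "\<And>x. x \<in> gp_domain \<gamma> \<sigma> \<Longrightarrow> G x = measure (density lborel (\<lambda>y. ennreal (h y))) {..x}"
  shows "has_density (the_cdf_on (gp_domain \<gamma> \<sigma>) G) h"
proof -
  let ?D = "gp_domain \<gamma> \<sigma>"
  define P where "P = density lborel (\<lambda>y. ennreal (h y))"
  note [measurable] = h(1)
  interpret P: prob_space P using h(3) by (simp add: P_def)
  have P_sets[measurable_cong]: "sets P = sets borel" and [simp]: "space P = UNIV" by (simp_all add: P_def)
  have P_D: "AE y in P. y \<in> ?D"
    unfolding P_def by (subst AE_density) (use h_zero in force)+
  define e where "e r = (\<chi> j. std1_inv (\<gamma> $ j) (\<sigma> $ j) r)" for r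
  have e_le: "r \<le> r' \<Longrightarrow> e r $ j \<le> e r' $ j" for r r' j by (simp add: e_def std1_inv_le_iff \<sigma>)
  have e_D: "e r \<in> ?D" for r using \<sigma> by (simp add: e_def gp_domain_def std1_inv_pos)
  have D_convex: "y \<in> ?D" if lower: "\<And>j. \<exists>a\<in>?D. a $ j \<le> y $ j" and upper: "\<And>j. \<exists>b\<in>?D. y $ j \<le> b $ j" for y
    unfolding gp_domain_def
  proof (intro CollectI allI)
    fix j
    obtain a b where ab: "a \<in> ?D" "a $ j \<le> y $ j" "b \<in> ?D" "y $ j \<le> b $ j"
      using lower[of j] upper[of j] by blast
    show "0 < \<gamma> $ j * y $ j + \<sigma> $ j"
    proof (cases "0 \<le> \<gamma> $ j")
      case True
      then have "\<gamma> $ j * a $ j \<le> \<gamma> $ j * y $ j" using ab by (intro mult_left_mono)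
      moreover have "0 < \<gamma> $ j * a $ j + \<sigma> $ j" using ab by (simp add: gp_domain_def)
      ultimately show ?thesis by linarith
    next
      case False
      then have "\<gamma> $ j * b $ j \<le> \<gamma> $ j * y $ j" using ab by (intro mult_left_mono_neg) auto
      moreover have "0 < \<gamma> $ j * b $ j + \<sigma> $ j" using ab by (simp add: gp_domain_def)
      ultimately show ?thesis by linarith
    qed
  qed
  have D_below: "\<exists>m::nat. e (- real m) $ j < y $ j" if "y \<in> ?D" for y j
  proof -
    obtain m :: nat where "- std1 (\<gamma> $ j) (\<sigma> $ j) (y $ j) < real m" using reals_Archimedean2 by blast
    then have "\<not> std1 (\<gamma> $ j) (\<sigma> $ j) (y $ j) \<le> - real m" by simp
    moreover have "0 < \<gamma> $ j * y $ j + \<sigma> $ j" using that by (simp add: gp_domain_def)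
    ultimately have "\<not> y $ j \<le> e (- real m) $ j" by (simp add: e_def std1_le_iff(1) \<sigma>)
    then show ?thesis by (auto simp: not_le)
  qed
  have D_above: "\<exists>n::nat. y \<le> e (real n)" if "y \<in> ?D" for y
  proof -
    obtain n :: nat where "Max (range (\<lambda>j. std1 (\<gamma> $ j) (\<sigma> $ j) (y $ j))) \<le> real n" using real_arch_simple by blast
    then have "std1 (\<gamma> $ j) (\<sigma> $ j) (y $ j) \<le> real n" for j by simp
    then show ?thesis
      using that \<sigma> by (auto simp: e_def gp_domain_def std1_le_iff(1) less_eq_vec_def)
  qed
  \<comment> \<open>Any competing distribution function, with law \<open>Q\<close>, equals that of \<open>P\<close>.\<close>
  have unique: "H = (\<lambda>x. measure P {..x})" if "is_cdf H" and HG: "\<forall>x\<in>?D. H x = G x" for H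
  proof -
    obtain Q where "prob_space Q" and Q_sets[measurable_cong]: "sets Q = sets borel" and H: "\<And>x. H x = measure Q {..x}"
      using \<open>is_cdf H\<close> by (auto simp: is_cdf_def)
    interpret Q: prob_space Q by fact
    have [simp]: "space Q = UNIV" using sets_eq_imp_space_eq[OF Q_sets] by simp
    have eq: "measure Q {..x} = measure P {..x}" if "x \<in> ?D" for x
      using that HG G by (simp add: H P_def)
    have "(\<lambda>n. measure P {..e (real n)}) \<longlonglongrightarrow> measure P (\<Union>n. {..e (real n)})"
      by (intro P.finite_Lim_measure_incseq) (auto simp: incseq_def less_eq_vec_def intro: order_trans[OF _ e_le])
    moreover have "measure P (\<Union>n. {..e (real n)}) = 1"
      using P_D D_above by (subst P.prob_eq_1) (auto elim!: eventually_mono)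
    ultimately have "(\<lambda>n. measure Q {..e (real n)}) \<longlonglongrightarrow> 1" by (simp add: eq e_D)
    moreover have "(\<lambda>n. measure Q {..e (real n)}) \<longlonglongrightarrow> measure Q (\<Union>n. {..e (real n)})"
      by (intro Q.finite_Lim_measure_incseq) (auto simp: incseq_def less_eq_vec_def intro: order_trans[OF _ e_le])
    ultimately have "measure Q (\<Union>n. {..e (real n)}) = 1" by (rule LIMSEQ_unique[rotated])
    then have above: "AE y in Q. \<exists>n::nat. y \<le> e (real n)"
      by (subst (asm) Q.prob_eq_1) auto
    have below: "AE y in Q. \<exists>m::nat. e (- real m) $ j < y $ j" for j
    proof -
      have "AE y in Q. \<not> (y \<le> e (real n) \<and> (\<forall>m::nat. y $ j \<le> e (- real m) $ j))" for n
      proof -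
        \<comment> \<open>The \<open>j\<close>-th component falls to the lower endpoint; the others stay fixed.\<close>
        let ?v = "\<lambda>m::nat. (\<chi> k. if k = j then e (- real m) $ k else e (real n) $ k)"
        have v_D: "?v m \<in> ?D" for m using e_D by (simp add: gp_domain_def)
        have v_dec: "decseq (\<lambda>m. {..?v m})"
          by (auto simp: decseq_def less_eq_vec_def intro: order_trans[OF _ e_le])
        have "(\<lambda>m. measure P {..?v m}) \<longlonglongrightarrow> measure P (\<Inter>m. {..?v m})"
          by (intro P.finite_Lim_measure_decseq v_dec) auto
        moreover have "AE y in P. y \<notin> (\<Inter>m. {..?v m})"
          using P_D
        proof eventually_elim
          case (elim y)
          obtain m :: nat where "e (- real m) $ j < y $ j" using D_below[OF elim] by blast
          then have "\<not> y \<le> ?v m" by (auto simp: less_eq_vec_def intro!: exI[of _ j])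
          then show ?case by auto
        qed
        then have "measure P (\<Inter>m. {..?v m}) = 0"
          by (subst P.prob_eq_0) auto
        moreover have "(\<lambda>m. measure Q {..?v m}) \<longlonglongrightarrow> measure Q (\<Inter>m. {..?v m})"
          by (intro Q.finite_Lim_measure_decseq v_dec) auto
        ultimately have "measure Q (\<Inter>m. {..?v m}) = 0"
          using LIMSEQ_unique by (simp add: eq v_D)
        then have "AE y in Q. y \<notin> (\<Inter>m. {..?v m})"
          by (subst (asm) Q.prob_eq_0) auto
        then show ?thesis
        proof eventually_elim
          case (elim y)
          then obtain m where "\<not> y \<le> ?v m" by auto
          then show ?case by (auto simp: less_eq_vec_def split: if_splits)
        qed
      qed
      then have "AE y in Q. \<forall>n::nat. \<not> (y \<le> e (real n) \<and> (\<forall>m::nat. y $ j \<le> e (- real m) $ j))"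
        by (subst AE_all_countable) blast
      then show ?thesis using above by eventually_elim (auto simp: not_le)
    qed
    then have "AE y in Q. \<forall>j. \<exists>m::nat. e (- real m) $ j < y $ j" by (subst AE_all_countable) blast
    then have Q_D: "AE y in Q. y \<in> ?D"
      using above
    proof eventually_elim
      case (elim y)
      show ?case
        by (rule D_convex) (use elim e_D in \<open>auto simp: less_eq_vec_def intro: less_imp_le\<close>, meson e_D less_imp_le)
    qed
    have "measure Q {..x} = measure P {..x}" for x
    proof (cases "\<forall>j. \<exists>m::nat. e (- real m) $ j \<le> x $ j")
      case False
      then obtain j where j: "\<And>m::nat. \<not> e (- real m) $ j \<le> x $ j" by blast
      have "y \<notin> {..x}" if y: "y \<in> ?D" for y
      proof
        assume "y \<in> {..x}"
        obtain m :: nat where "e (- real m) $ j < y $ j" using D_below[OF y] by blast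
        also have "y $ j \<le> x $ j" using \<open>y \<in> {..x}\<close> by (simp add: less_eq_vec_def)
        finally show False using j[of m] by simp
      qed
      then have "AE y in P. y \<notin> {..x}" "AE y in Q. y \<notin> {..x}"
        using P_D Q_D by (auto elim!: eventually_mono)
      then have "measure P {..x} = 0" "measure Q {..x} = 0"
        by (subst P.prob_eq_0 Q.prob_eq_0; simp)+
      then show ?thesis by simp
    next
      case True
      \<comment> \<open>\<open>x\<close> need not lie below the upper corner of the domain, so it is approached by truncation.\<close>
      let ?x = "\<lambda>n::nat. (\<chi> j. min (x $ j) (e (real n) $ j))"
      have x_D: "?x n \<in> ?D" for n
      proof (rule D_convex)
        fix j
        obtain m :: nat where m: "e (- real m) $ j \<le> x $ j" using True by blast
        show "\<exists>a\<in>?D. a $ j \<le> ?x n $ j"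
          using m e_le[of "- real m" "real n" j] by (intro bexI[OF _ e_D[of "- real m"]]) simp
        show "\<exists>b\<in>?D. ?x n $ j \<le> b $ j" by (intro bexI[OF _ e_D[of "real n"]]) simp
      qed
      have x_inc: "incseq (\<lambda>n. {..?x n})"
        by (auto simp: incseq_def less_eq_vec_def intro: order_trans[OF _ e_le] min.coboundedI2 e_le)
      have x_Union: "y \<in> {..x} \<longleftrightarrow> y \<in> (\<Union>n. {..?x n})" if y: "y \<in> ?D" for y
        using D_above[OF y] by (auto simp: less_eq_vec_def)
      have "measure P {..x} = measure P (\<Union>n. {..?x n})"
        using P_D x_Union by (intro P.finite_measure_eq_AE) (auto elim!: eventually_mono)
      moreover have "measure Q {..x} = measure Q (\<Union>n. {..?x n})"
        using Q_D x_Union by (intro Q.finite_measure_eq_AE) (auto elim!: eventually_mono)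
      moreover have "(\<lambda>n. measure P {..?x n}) \<longlonglongrightarrow> measure P (\<Union>n. {..?x n})"
        by (intro P.finite_Lim_measure_incseq x_inc) auto
      moreover have "(\<lambda>n. measure Q {..?x n}) \<longlonglongrightarrow> measure Q (\<Union>n. {..?x n})"
        by (intro Q.finite_Lim_measure_incseq x_inc) auto
      ultimately show ?thesis using LIMSEQ_unique by (simp add: eq x_D)
    qed
    then show ?thesis by (auto simp: H)
  qed
  have "the_cdf_on ?D G = (\<lambda>x. measure P {..x})"
    unfolding the_cdf_on_def
  proof (rule the_equality)
    show "is_cdf (\<lambda>x. measure P {..x}) \<and> (\<forall>x\<in>?D. measure P {..x} = G x)"
      using P.prob_space_axioms P_sets G by (auto simp: is_cdf_def P_def)
  qed (use unique in blast)
  then show ?thesis using h by (simp add: has_density_def P_def)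
qed

section \<open>The density built from U\<close>

lemma nn_integral_of_distr:
  assumes "Z \<in> borel_measurable M" "distr M borel Z = P" "g \<in> borel_measurable borel"
  shows "(\<integral>\<^sup>+ z. g z \<partial>P) = (\<integral>\<^sup>+ \<omega>. g (Z \<omega>) \<partial>M)"
  unfolding assms(2)[symmetric] using assms(1,3) by (simp add: nn_integral_distr)

proposition H_U_has_density:
  fixes \<gamma> \<sigma> :: "real ^ 'd::finite"
  assumes "prob_space M" and \<sigma>: "\<And>j. 0 < \<sigma> $ j"
    and U: "random_vector M U" "U_admissible M U" and f: "has_density (dist_fun M U) f"
  shows "has_density (H_U \<gamma> \<sigma> M U) (h_U \<gamma> \<sigma> (dist_fun M U) f)"
proof -
  let ?F = "dist_fun M U" and ?J = "\<lambda>(t::real) y. \<Prod>j\<in>UNIV. inverse (\<gamma> $ j * y $ j + \<sigma> $ j)"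
  interpret scaling_family "gp_domain \<gamma> \<sigma>" "gp_domain \<gamma> \<sigma>" UNIV
    "\<lambda>t y. add_scalar (gp_std \<gamma> \<sigma> y) (ln t)" ?J
    by (rule scaling_family_std) (rule \<sigma>)
  obtain Z where Z: "Z \<in> borel_measurable M" "AE \<omega> in M. \<forall>j. U \<omega> j = ereal (Z \<omega> $ j)"
    "distr M borel Z = density lborel (\<lambda>y. ennreal (f y))"
    using real_random_vector_of_density[OF assms(1) U(1) f] .
  have s0: "add_scalar (gp_std \<gamma> \<sigma> 0) (ln t) = (\<chi> j. ln t)" for t
    by (simp add: add_scalar_def gp_std_def vec_eq_iff)
  have denom: "(LBINT t:{0<..}. 1 - ?F (add_scalar (gp_std \<gamma> \<sigma> 0) (ln t))) = U_denom ?F"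
    by (simp add: U_denom_def s0)
  have le_iff: "z \<le> add_scalar (gp_std \<gamma> \<sigma> 0) (ln t) \<longleftrightarrow> (\<forall>j. exp (z $ j) \<le> t)" if "0 < t" for t z
    using that by (simp add: s0 less_eq_vec_def ln_ge_iff)
  have fin: "(\<integral>\<^sup>+ z. ennreal (exp (z $ j)) \<partial>density lborel (\<lambda>y. ennreal (f y))) < \<infinity>" for j
  proof -
    have "(\<integral>\<^sup>+ z. ennreal (exp (z $ j)) \<partial>density lborel (\<lambda>y. ennreal (f y))) = (\<integral>\<^sup>+ \<omega>. ennreal (exp (Z \<omega> $ j)) \<partial>M)"
      by (rule nn_integral_of_distr[OF Z(1,3)]) measurable
    also have "\<dots> = (\<integral>\<^sup>+ \<omega>. ext_exp (U \<omega> j) \<partial>M)"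
      using Z(2) by (intro nn_integral_cong_AE) (auto simp: ext_exp_def elim!: eventually_mono)
    also have "\<dots> < \<infinity>" using U(2) by (simp add: U_admissible_def)
    finally show ?thesis .
  qed
  have h: "h_U \<gamma> \<sigma> ?F f y = (if y \<in> gp_domain \<gamma> \<sigma> \<and> \<not> y \<le> 0
      then 1 / (LBINT t:{0<..}. 1 - ?F (add_scalar (gp_std \<gamma> \<sigma> 0) (ln t))) *
        (LBINT t:{0<..}. ?J t y * f (add_scalar (gp_std \<gamma> \<sigma> y) (ln t))) else 0)" for y
    unfolding denom by (simp add: h_U_def set_integral_mult_right)
  note main = normalised_mixture_density[where V = "\<lambda>j z. exp (z $ j)", OF f _ _ le_iff _ fin h]
  show ?thesis
    unfolding H_U_def
  proof (rule has_density_the_cdf_on[OF \<sigma>])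
    show "h_U \<gamma> \<sigma> ?F f \<in> borel_measurable borel" by (rule main(1)) auto
    show "0 \<le> h_U \<gamma> \<sigma> ?F f y" for y by (rule main(2)) auto
    show "prob_space (density lborel (\<lambda>y. ennreal (h_U \<gamma> \<sigma> ?F f y)))" by (rule main(3)) auto
    show "h_U \<gamma> \<sigma> ?F f y = 0" if "y \<notin> gp_domain \<gamma> \<sigma>" for y using that by (simp add: h_U_def)
    show "(LBINT t:{0<..}. ?F (add_scalar (gp_std \<gamma> \<sigma> x) (ln t)) - ?F (add_scalar (gp_std \<gamma> \<sigma> (neg_part_vec x)) (ln t)))
        / U_denom ?F = measure (density lborel (\<lambda>y. ennreal (h_U \<gamma> \<sigma> ?F f y))) {..x}"
      if "x \<in> gp_domain \<gamma> \<sigma>" for x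
      unfolding denom[symmetric] by (rule main(4)) (use that in auto)
  qed
qed

section \<open>The density built from R\<close>

lemma AE_lborel_component_nonzero: "AE z in lborel. (z :: real ^ 'd::finite) $ j \<noteq> 0"
proof -
  have "{z :: real ^ 'd. z $ j = 0} \<in> null_sets lborel"
    using negligible_standard_hyperplane_cart[of j]
    by (subst (asm) negligible_iff_null_sets, subst (asm) null_sets_completion_iff) auto
  from AE_not_in[OF this] show ?thesis by eventually_elim simp
qed

text \<open>
  \<open>H\<^sub>R\<close> is given by its formula at every point, so the order relations are needed with \<open>X = UNIV\<close>. The
  sign conditions on \<open>R\<close> are weak inequalities for \<open>\<gamma>\<^sub>j > 0\<close>; they become strict almost surely because
  a hyperplane is a Lebesgue null set.
\<close>
proposition H_R_has_density:
  fixes \<gamma> \<sigma> :: "real ^ 'd::finite"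
  assumes "prob_space M" and \<sigma>: "\<And>j. 0 < \<sigma> $ j"
    and R: "random_vector M R" "R_admissible \<gamma> \<sigma> M R" and f: "has_density (dist_fun M R) f"
  shows "has_density (H_R \<gamma> \<sigma> M R) (h_R \<gamma> \<sigma> (dist_fun M R) f)"
proof -
  let ?F = "dist_fun M R"
  interpret scaling_family "gp_domain \<gamma> \<sigma>" UNIV "sign_cone \<gamma>"
    "gp_scale \<gamma> \<sigma>" "\<lambda>t y. t powr (\<Sum>j\<in>UNIV. \<gamma> $ j)"
    by (rule scaling_family_scale) (rule \<sigma>)
  obtain Z where Z: "Z \<in> borel_measurable M" "AE \<omega> in M. \<forall>j. R \<omega> j = ereal (Z \<omega> $ j)"
    "distr M borel Z = density lborel (\<lambda>y. ennreal (f y))"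
    using real_random_vector_of_density[OF assms(1) R(1) f] .
  note [measurable] = has_densityD(1)[OF f] Z(1)
  have R_adm: "\<gamma> $ j > 0 \<Longrightarrow> AE \<omega> in M. 0 \<le> R \<omega> j" "\<gamma> $ j < 0 \<Longrightarrow> AE \<omega> in M. R \<omega> j < 0"
    "\<gamma> $ j \<noteq> 0 \<Longrightarrow> (\<integral>\<^sup>+ \<omega>. ext_abs_powr (R \<omega> j) (1 / \<gamma> $ j) \<partial>M) < \<infinity>"
    "\<gamma> $ j = 0 \<Longrightarrow> (\<integral>\<^sup>+ \<omega>. ext_exp (R \<omega> j / ereal (\<sigma> $ j)) \<partial>M) < \<infinity>" for j
    using R(2) by (auto simp: R_admissible_def)
  have E: "AE z in density lborel (\<lambda>y. ennreal (f y)). z \<in> sign_cone \<gamma>"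
  proof -
    have "AE z in density lborel (\<lambda>y. ennreal (f y)). (0 < \<gamma> $ j \<longrightarrow> 0 < z $ j) \<and> (\<gamma> $ j < 0 \<longrightarrow> z $ j < 0)" for j
    proof -
      have "AE \<omega> in M. (0 < \<gamma> $ j \<longrightarrow> 0 \<le> Z \<omega> $ j) \<and> (\<gamma> $ j < 0 \<longrightarrow> Z \<omega> $ j < 0)"
      proof (cases "\<gamma> $ j" "0 :: real" rule: linorder_cases)
        case less
        show ?thesis using R_adm(2)[OF less] Z(2) by eventually_elim (use less in \<open>auto dest: spec[of _ j]\<close>)
      next
        case greater
        show ?thesis using R_adm(1)[OF greater] Z(2) by eventually_elim (use greater in \<open>auto dest: spec[of _ j]\<close>)
      qed simp
      then have "AE z in density lborel (\<lambda>y. ennreal (f y)). (0 < \<gamma> $ j \<longrightarrow> 0 \<le> z $ j) \<and> (\<gamma> $ j < 0 \<longrightarrow> z $ j < 0)"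
        unfolding Z(3)[symmetric] by (subst AE_distr_iff) auto
      moreover have "AE z in density lborel (\<lambda>y. ennreal (f y)). z $ j \<noteq> 0"
        by (subst AE_density) (use AE_lborel_component_nonzero[of j] in \<open>auto elim!: eventually_mono\<close>)
      ultimately show ?thesis by eventually_elim auto
    qed
    then have "AE z in density lborel (\<lambda>y. ennreal (f y)). \<forall>j. (0 < \<gamma> $ j \<longrightarrow> 0 < z $ j) \<and> (\<gamma> $ j < 0 \<longrightarrow> z $ j < 0)"
      by (subst AE_all_countable) blast
    then show ?thesis by (simp add: sign_cone_def)
  qed
  \<comment> \<open>\<open>z\<^sub>j \<le> t\<^sup>\<gamma> \<sigma>/\<gamma>\<close> in the \<open>j\<close>-th component, solved for \<open>t\<close>, reads \<open>V j z \<le> t\<close>.\<close>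
  define V where "V j z = (if \<gamma> $ j = 0 then exp (z $ j / \<sigma> $ j) else (\<gamma> $ j / \<sigma> $ j * z $ j) powr (1 / \<gamma> $ j))"
    for j and z :: "real ^ 'd"
  have [measurable]: "V j \<in> borel_measurable borel" for j unfolding V_def by measurable
  have arg_pos: "0 < \<gamma> $ j / \<sigma> $ j * z $ j" if "z \<in> sign_cone \<gamma>" "\<gamma> $ j \<noteq> 0" for j z
    using that \<sigma>[of j] by (cases "0 < \<gamma> $ j") (auto simp: sign_cone_def zero_less_mult_iff zero_less_divide_iff divide_less_0_iff)
  have V_pos: "0 < V j z" if "z \<in> sign_cone \<gamma>" for j z
    using arg_pos[OF that, of j] by (auto simp: V_def)
  have le_iff: "z \<le> gp_scale \<gamma> \<sigma> t 0 \<longleftrightarrow> (\<forall>j. V j z \<le> t)" if t: "0 < t" and z: "z \<in> sign_cone \<gamma>" for t z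
  proof -
    have "z $ j \<le> gp_scale \<gamma> \<sigma> t 0 $ j \<longleftrightarrow> V j z \<le> t" for j
    proof (cases "\<gamma> $ j = 0")
      case True
      have "V j z \<le> t \<longleftrightarrow> z $ j / \<sigma> $ j \<le> ln t" using t True by (simp add: V_def ln_ge_iff)
      then show ?thesis using True \<sigma>[of j] by (simp add: gp_scale_def divide_le_eq mult.commute)
    next
      case False
      define a where "a = \<gamma> $ j / \<sigma> $ j * z $ j"
      have a: "0 < a" using arg_pos[OF z False] by (simp add: a_def)
      have zj: "z $ j = \<sigma> $ j / \<gamma> $ j * a" using False \<sigma>[of j] by (simp add: a_def)
      have V: "V j z = a powr (1 / \<gamma> $ j)" using False by (simp add: V_def a_def)
      show ?thesis
      proof (cases "0 < \<gamma> $ j")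
        case True
        have "V j z \<le> t \<longleftrightarrow> (a powr (1 / \<gamma> $ j)) powr \<gamma> $ j \<le> t powr \<gamma> $ j"
          unfolding V using True t powr_less_mono2[of "\<gamma> $ j" t "a powr (1 / \<gamma> $ j)"]
            powr_mono2[of "\<gamma> $ j" "a powr (1 / \<gamma> $ j)" t] by (auto simp: not_le[symmetric])
        also have "(a powr (1 / \<gamma> $ j)) powr \<gamma> $ j = a" using a False by (simp add: powr_powr)
        also have "a \<le> t powr \<gamma> $ j \<longleftrightarrow> z $ j \<le> gp_scale \<gamma> \<sigma> t 0 $ j"
          using True \<sigma>[of j] by (simp add: zj gp_scale_def mult.commute[of "t powr _"] mult_le_cancel_left_pos divide_pos_pos del: times_divide_eq_left times_divide_eq_right)
        finally show ?thesis by simp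
      next
        case neg: False
        then have neg: "\<gamma> $ j < 0" using False by simp
        have "V j z \<le> t \<longleftrightarrow> t powr \<gamma> $ j \<le> (a powr (1 / \<gamma> $ j)) powr \<gamma> $ j"
          unfolding V using neg t a powr_less_mono2_neg[of "\<gamma> $ j" t "a powr (1 / \<gamma> $ j)"]
            powr_mono2'[of "\<gamma> $ j" "a powr (1 / \<gamma> $ j)" t] by (auto simp: not_le[symmetric])
        also have "(a powr (1 / \<gamma> $ j)) powr \<gamma> $ j = a" using a False by (simp add: powr_powr)
        also have "t powr \<gamma> $ j \<le> a \<longleftrightarrow> z $ j \<le> gp_scale \<gamma> \<sigma> t 0 $ j"
          using neg \<sigma>[of j] False by (simp add: zj gp_scale_def mult.commute[of "t powr _"] mult_le_cancel_left_neg divide_pos_neg del: times_divide_eq_left times_divide_eq_right)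
        finally show ?thesis by simp
      qed
    qed
    then show ?thesis by (simp add: less_eq_vec_def)
  qed
  have fin: "(\<integral>\<^sup>+ z. ennreal (V j z) \<partial>density lborel (\<lambda>y. ennreal (f y))) < \<infinity>" for j
  proof -
    have "(\<integral>\<^sup>+ z. ennreal (V j z) \<partial>density lborel (\<lambda>y. ennreal (f y))) = (\<integral>\<^sup>+ \<omega>. ennreal (V j (Z \<omega>)) \<partial>M)"
      by (rule nn_integral_of_distr[OF Z(1,3)]) measurable
    also have "\<dots> < \<infinity>"
    proof (cases "\<gamma> $ j = 0")
      case True
      have "(\<integral>\<^sup>+ \<omega>. ennreal (V j (Z \<omega>)) \<partial>M) = (\<integral>\<^sup>+ \<omega>. ext_exp (R \<omega> j / ereal (\<sigma> $ j)) \<partial>M)"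
        using Z(2) True less_imp_neq[OF \<sigma>[of j]]
        by (intro nn_integral_cong_AE) (auto simp: ext_exp_def V_def elim!: eventually_mono)
      then show ?thesis using R_adm(4)[OF True] by simp
    next
      case False
      have "AE \<omega> in M. Z \<omega> \<in> sign_cone \<gamma>"
        using E unfolding Z(3)[symmetric] by (subst (asm) AE_distr_iff) auto
      then have "AE \<omega> in M. ennreal (V j (Z \<omega>))
          = ennreal (\<bar>\<gamma> $ j / \<sigma> $ j\<bar> powr (1 / \<gamma> $ j)) * ext_abs_powr (R \<omega> j) (1 / \<gamma> $ j)"
        using Z(2)
      proof eventually_elim
        case (elim \<omega>)
        have pos: "0 < \<gamma> $ j / \<sigma> $ j * Z \<omega> $ j" by (rule arg_pos[OF elim(1) False])
        then have "\<gamma> $ j / \<sigma> $ j * Z \<omega> $ j = \<bar>\<gamma> $ j / \<sigma> $ j\<bar> * \<bar>Z \<omega> $ j\<bar>"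
          by (metis abs_mult abs_of_pos)
        then have "V j (Z \<omega>) = \<bar>\<gamma> $ j / \<sigma> $ j\<bar> powr (1 / \<gamma> $ j) * \<bar>Z \<omega> $ j\<bar> powr (1 / \<gamma> $ j)"
          using False by (simp only: V_def if_False powr_mult abs_ge_zero)
        moreover have "Z \<omega> $ j \<noteq> 0" using pos by auto
        ultimately show ?case using elim(2)
          by (simp add: ext_abs_powr_def ennreal_mult)
      qed
      then have "(\<integral>\<^sup>+ \<omega>. ennreal (V j (Z \<omega>)) \<partial>M)
          = (\<integral>\<^sup>+ \<omega>. ennreal (\<bar>\<gamma> $ j / \<sigma> $ j\<bar> powr (1 / \<gamma> $ j)) * ext_abs_powr (R \<omega> j) (1 / \<gamma> $ j) \<partial>M)"
        by (rule nn_integral_cong_AE)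
      also have "\<dots> = ennreal (\<bar>\<gamma> $ j / \<sigma> $ j\<bar> powr (1 / \<gamma> $ j)) * (\<integral>\<^sup>+ \<omega>. ext_abs_powr (R \<omega> j) (1 / \<gamma> $ j) \<partial>M)"
      proof (rule nn_integral_cmult)
        have [measurable]: "(\<lambda>\<omega>. R \<omega> j) \<in> borel_measurable M" using R(1) by (simp add: random_vector_def)
        show "(\<lambda>\<omega>. ext_abs_powr (R \<omega> j) (1 / \<gamma> $ j)) \<in> borel_measurable M"
          unfolding ext_abs_powr_def by measurable
      qed
      also have "\<dots> < \<infinity>" using R_adm(3)[OF False] by (simp add: ennreal_mult_less_top)
      finally show ?thesis .
    qed
    finally show ?thesis .
  qed
  have h: "h_R \<gamma> \<sigma> ?F f y = (if y \<in> gp_domain \<gamma> \<sigma> \<and> \<not> y \<le> 0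
      then 1 / (LBINT t:{0<..}. 1 - ?F (gp_scale \<gamma> \<sigma> t 0)) *
        (LBINT t:{0<..}. t powr (\<Sum>j\<in>UNIV. \<gamma> $ j) * f (gp_scale \<gamma> \<sigma> t y)) else 0)" for y
    by (simp add: h_R_def R_denom_def)
  note main = normalised_mixture_density[where V = V, OF f E _ le_iff V_pos fin h]
  show ?thesis
    unfolding has_density_def
  proof (intro conjI allI)
    show "h_R \<gamma> \<sigma> ?F f \<in> borel_measurable borel" by (rule main(1)) auto
    show "0 \<le> h_R \<gamma> \<sigma> ?F f y" for y by (rule main(2)) auto
    show "prob_space (density lborel (\<lambda>y. ennreal (h_R \<gamma> \<sigma> ?F f y)))" by (rule main(3)) auto
    show "H_R \<gamma> \<sigma> M R x = measure (density lborel (\<lambda>y. ennreal (h_R \<gamma> \<sigma> ?F f y))) {..x}" for x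
      unfolding H_R_def R_denom_def by (rule main(4)) auto
  qed
qed

section \<open>The density built from T\<close>

text \<open>
  The largest component of a vector.
\<close>
definition vec_max :: "real ^ 'd::finite \<Rightarrow> real" where
  "vec_max z = Max (range (($) z))"

lemma vec_max_measurable [measurable (raw)]:
  assumes [measurable]: "g \<in> borel_measurable N"
  shows "(\<lambda>x. vec_max (g x)) \<in> borel_measurable N"
  unfolding vec_max_def by measurable

lemma add_scalar_measurable [measurable (raw)]:
  assumes [measurable]: "g \<in> borel_measurable N" "c \<in> borel_measurable N"
  shows "(\<lambda>x. add_scalar (g x) (c x)) \<in> borel_measurable N"
  unfolding add_scalar_def by measurable

lemma vec_max_add_scalar: "vec_max (add_scalar z c) = vec_max z + c"
  using mono_Max_commute[of "\<lambda>x. x + c" "range (($) z)"]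
  by (simp add: vec_max_def add_scalar_def mono_def image_image)

lemma Max_range_exp: "Max (range (\<lambda>j. exp (z $ j))) = exp (vec_max z)"
  using mono_Max_commute[of exp "range (($) z)"] by (simp add: vec_max_def mono_def image_image)

text \<open>
  The law of \<open>T - max\<^sub>j T\<^sub>j\<close>, which has no density itself, expressed through the density of \<open>T\<close>.
\<close>
lemma dist_fun_spectral:
  fixes T :: "'a \<Rightarrow> 'd::finite \<Rightarrow> ereal"
  assumes "prob_space M" "random_vector M T" and f: "has_density (dist_fun M T) f"
  shows "dist_fun M (spectral T) w
    = measure (density lborel (\<lambda>y. ennreal (f y))) {z. add_scalar z (- vec_max z) \<le> w}"
proof -
  interpret M: prob_space M by fact
  obtain Z where Z[measurable]: "Z \<in> borel_measurable M" and TZ: "AE \<omega> in M. \<forall>j. T \<omega> j = ereal (Z \<omega> $ j)"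
    and distr: "distr M borel Z = density lborel (\<lambda>y. ennreal (f y))"
    using real_random_vector_of_density[OF assms] .
  have [measurable]: "(\<lambda>\<omega>. T \<omega> j) \<in> borel_measurable M" for j
    using assms(2) by (simp add: random_vector_def)
  have spec_eq: "spectral T \<omega> j \<le> ereal (w $ j) \<longleftrightarrow> Z \<omega> $ j - vec_max (Z \<omega>) \<le> w $ j"
    if "\<forall>j. T \<omega> j = ereal (Z \<omega> $ j)" for \<omega> j
  proof -
    have "Max (range (T \<omega>)) = Max (ereal ` range (($) (Z \<omega>)))"
      using that by (simp add: image_image)
    also have "\<dots> = ereal (vec_max (Z \<omega>))"
      unfolding vec_max_def by (rule mono_Max_commute[symmetric]) (auto simp: mono_def)
    finally show ?thesis using that by (simp add: spectral_def)
  qed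
  have [measurable]: "{z :: real ^ 'd. add_scalar z (- vec_max z) \<le> w} \<in> sets borel"
    unfolding add_scalar_def by measurable
  have "dist_fun M (spectral T) w = measure M {\<omega>\<in>space M. add_scalar (Z \<omega>) (- vec_max (Z \<omega>)) \<le> w}"
    unfolding dist_fun_def
  proof (rule M.finite_measure_eq_AE)
    show "AE \<omega> in M. \<omega> \<in> {\<omega> \<in> space M. \<forall>j. spectral T \<omega> j \<le> ereal (w $ j)} \<longleftrightarrow>
        \<omega> \<in> {\<omega> \<in> space M. add_scalar (Z \<omega>) (- vec_max (Z \<omega>)) \<le> w}"
      using TZ by eventually_elim (simp add: spec_eq less_eq_vec_def add_scalar_def)
    show "{\<omega> \<in> space M. \<forall>j. spectral T \<omega> j \<le> ereal (w $ j)} \<in> sets M"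
      unfolding spectral_def by measurable
    show "{\<omega> \<in> space M. add_scalar (Z \<omega>) (- vec_max (Z \<omega>)) \<le> w} \<in> sets M"
      unfolding add_scalar_def by measurable
  qed
  also have "\<dots> = measure (distr M borel Z) {z. add_scalar z (- vec_max z) \<le> w}"
    by (subst measure_distr) (auto intro!: arg_cong[where f = "measure M"])
  finally show ?thesis by (simp add: distr)
qed

lemma gp_pareto_eq:
  assumes "\<And>j. 0 < \<sigma> $ j" "x \<in> gp_domain \<gamma> \<sigma>"
  shows "gp_pareto \<gamma> \<sigma> x j = exp (gp_std \<gamma> \<sigma> x $ j)"
proof (cases "\<gamma> $ j = 0")
  case False
  have "0 < \<gamma> $ j / \<sigma> $ j * x $ j + 1"
    by (rule std1_arg_pos) (use assms in \<open>auto simp: gp_domain_def\<close>)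
  then show ?thesis using False by (simp add: gp_pareto_def gp_std_def powr_def)
qed (simp add: gp_pareto_def gp_std_def)

text \<open>
  Here \<open>V j z = exp z\<^sub>j\<close> and the weight is \<open>\<phi> z = exp (- max\<^sub>j z\<^sub>j) f z\<close>, for which the
  normalising constant is \<open>\<integral> f = 1\<close> without any moment condition.
\<close>
proposition H_T_has_density:
  fixes \<gamma> \<sigma> :: "real ^ 'd::finite"
  assumes "prob_space M" and \<sigma>: "\<And>j. 0 < \<sigma> $ j"
    and T: "random_vector M T" and f: "has_density (dist_fun M T) f"
  shows "has_density (H_T \<gamma> \<sigma> M T) (h_T \<gamma> \<sigma> f)"
proof -
  let ?J = "\<lambda>(t::real) y. \<Prod>j\<in>UNIV. inverse (\<gamma> $ j * y $ j + \<sigma> $ j)"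
  let ?S = "\<lambda>t y. add_scalar (gp_std \<gamma> \<sigma> y) (ln t)"
  interpret scaling_family "gp_domain \<gamma> \<sigma>" "gp_domain \<gamma> \<sigma>" UNIV ?S ?J
    by (rule scaling_family_std) (rule \<sigma>)
  define P where "P = density lborel (\<lambda>y. ennreal (f y))"
  interpret P: prob_space P using has_densityD(3)[OF f] by (simp add: P_def)
  have [measurable_cong]: "sets P = sets borel" and [simp]: "space P = UNIV" by (simp_all add: P_def)
  note f_meas[measurable] = has_densityD(1)[OF f] and f_nonneg = has_densityD(2)[OF f]
  define \<phi> where "\<phi> z = exp (- vec_max z) * f z" for z
  have \<phi>_meas[measurable]: "\<phi> \<in> borel_measurable borel" unfolding \<phi>_def by measurable
  have \<phi>_nonneg: "0 \<le> \<phi> z" for z by (simp add: \<phi>_def f_nonneg)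
  have S0: "z \<le> ?S t 0 \<longleftrightarrow> (\<forall>j. exp (z $ j) \<le> t)" if "0 < t" for t and z :: "real ^ 'd"
    using that by (simp add: add_scalar_def gp_std_def less_eq_vec_def ln_ge_iff)
  have "scaled_mass \<phi> (\<lambda>t. {z. \<not> z \<le> ?S t 0})
      = (\<integral>\<^sup>+ z. indicator UNIV z * (ennreal (\<phi> z) * ennreal (Max (range (\<lambda>j. exp (z $ j))))) \<partial>lborel)"
    by (rule scaled_mass_total) (auto simp: S0)
  also have "\<dots> = (\<integral>\<^sup>+ z. ennreal (f z) \<partial>lborel)"
    by (intro nn_integral_cong)
      (simp add: Max_range_exp \<phi>_def f_nonneg exp_minus flip: ennreal_mult')
  also have "\<dots> = emeasure P UNIV" by (simp add: P_def emeasure_density)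
  finally have c: "scaled_mass \<phi> (\<lambda>t. {z. \<not> z \<le> ?S t 0}) = ennreal 1"
    using P.emeasure_space_1 by simp
  have h: "h_T \<gamma> \<sigma> f y = (if y \<in> gp_domain \<gamma> \<sigma> \<and> \<not> y \<le> 0
      then 1 / 1 * (LBINT t:{0<..}. ?J t y * \<phi> (?S t y)) else 0)" for y
  proof (cases "y \<in> gp_domain \<gamma> \<sigma>")
    case True
    let ?m = "exp (vec_max (gp_std \<gamma> \<sigma> y))"
    have "(LBINT t:{0<..}. ?J t y * \<phi> (?S t y)) = (LBINT t:{0<..}. ?J 1 y / ?m * (inverse t * f (?S t y)))"
    proof (rule set_lebesgue_integral_cong)
      show "\<forall>t. t \<in> {0<..} \<longrightarrow> ?J t y * \<phi> (?S t y) = ?J 1 y / ?m * (inverse t * f (?S t y))"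
      proof (intro allI impI)
        fix t :: real assume "t \<in> {0<..}"
        then have t: "0 < t" by simp
        have "vec_max (?S t y) = vec_max (gp_std \<gamma> \<sigma> y) + ln t"
          by (rule vec_max_add_scalar)
        then have "exp (- vec_max (?S t y)) = inverse ?m * inverse t"
          using t by (simp only: exp_minus exp_add exp_ln inverse_mult_distrib)
        then show "?J t y * \<phi> (?S t y) = ?J 1 y / ?m * (inverse t * f (?S t y))"
          by (simp add: \<phi>_def divide_inverse)
      qed
    qed simp
    then show ?thesis
      by (simp add: h_T_def gp_pareto_eq \<sigma> True Max_range_exp set_integral_mult_right)
  qed (simp add: h_T_def)
  note main = mixture_density[OF \<phi>_meas \<phi>_nonneg c zero_less_one h]
  have mass: "scaled_mass \<phi> (\<lambda>t. {z. z \<le> ?S t x \<and> \<not> z \<le> ?S t 0})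
      = (\<integral>\<^sup>+ u. indicator {0<..<1} u * emeasure P {z. add_scalar z (- vec_max z) \<le> ?S u x} \<partial>lborel)" for x
  proof -
    have "scaled_mass \<phi> (\<lambda>t. {z. z \<le> ?S t x \<and> \<not> z \<le> ?S t 0})
        = (\<integral>\<^sup>+ t. \<integral>\<^sup>+ z. indicator {0<..} t * (indicator {..?S t x} z * (indicator {..<exp (vec_max z)} t * ennreal (\<phi> z))) \<partial>lborel \<partial>lborel)"
      unfolding scaled_mass_def
    proof (intro nn_integral_cong)
      fix t :: real
      show "indicator {0<..} t * (\<integral>\<^sup>+ z. indicator UNIV z * (indicator {z. z \<le> ?S t x \<and> \<not> z \<le> ?S t 0} z * ennreal (\<phi> z)) \<partial>lborel)
          = (\<integral>\<^sup>+ z. indicator {0<..} t * (indicator {..?S t x} z * (indicator {..<exp (vec_max z)} t * ennreal (\<phi> z))) \<partial>lborel)"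
      proof (cases "0 < t")
        case True
        show ?thesis
        proof (subst nn_integral_cmult[symmetric], measurable, intro nn_integral_cong)
          fix z
          have "\<not> z \<le> ?S t 0 \<longleftrightarrow> t < exp (vec_max z)"
            unfolding S0[OF True] Max_range_exp[symmetric] by (simp add: Max_gr_iff not_le)
          then show "indicator {0<..} t * (indicator UNIV z * (indicator {z. z \<le> ?S t x \<and> \<not> z \<le> ?S t 0} z * ennreal (\<phi> z)))
              = indicator {0<..} t * (indicator {..?S t x} z * (indicator {..<exp (vec_max z)} t * ennreal (\<phi> z)))"
            by (simp add: indicator_def)
        qed
      qed simp
    qed
    also have "\<dots> = (\<integral>\<^sup>+ z. \<integral>\<^sup>+ t. indicator {0<..} t * (indicator {..?S t x} z * (indicator {..<exp (vec_max z)} t * ennreal (\<phi> z))) \<partial>lborel \<partial>lborel)"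
      by (rule lborel_pair.Fubini') (simp add: indicator_def)
    also have "\<dots> = (\<integral>\<^sup>+ z. \<integral>\<^sup>+ u. indicator {0<..<1} u * (of_bool (add_scalar z (- vec_max z) \<le> ?S u x) * ennreal (f z)) \<partial>lborel \<partial>lborel)"
    proof (rule nn_integral_cong)
      fix z :: "real ^ 'd"
      let ?m = "exp (vec_max z)"
      \<comment> \<open>Rescaling \<open>t = u exp (max\<^sub>j z\<^sub>j)\<close> turns \<open>t < exp (max\<^sub>j z\<^sub>j)\<close> into \<open>u < 1\<close> and cancels the exponential in \<open>\<phi>\<close>.\<close>
      let ?g = "\<lambda>t. indicator {0<..} t * (of_bool (z \<le> ?S t x) * (indicator {..<?m} t * ennreal (\<phi> z)))"
      have "(\<integral>\<^sup>+ t. indicator {0<..} t * (indicator {..?S t x} z * (indicator {..<?m} t * ennreal (\<phi> z))) \<partial>lborel)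
          = (\<integral>\<^sup>+ t. ?g t \<partial>lborel)"
        by (intro nn_integral_cong) (auto split: split_indicator)
      also have "\<dots> = ennreal \<bar>?m\<bar> * (\<integral>\<^sup>+ u. ?g (0 + ?m * u) \<partial>lborel)"
        by (rule nn_integral_real_affine) auto
      also have "\<dots> = (\<integral>\<^sup>+ u. ennreal ?m * ?g (0 + ?m * u) \<partial>lborel)"
        by (subst nn_integral_cmult) auto
      also have "\<dots> = (\<integral>\<^sup>+ u. indicator {0<..<1} u * (of_bool (add_scalar z (- vec_max z) \<le> ?S u x) * ennreal (f z)) \<partial>lborel)"
      proof (intro nn_integral_cong)
        fix u :: real
        have "ennreal ?m * ennreal (\<phi> z) = ennreal (f z)"
          by (simp add: \<phi>_def exp_minus f_nonneg flip: ennreal_mult')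
        moreover have "z \<le> ?S (?m * u) x \<longleftrightarrow> add_scalar z (- vec_max z) \<le> ?S u x" if "0 < u"
          using that by (simp add: less_eq_vec_def add_scalar_def ln_mult algebra_simps)
        moreover have "?m * u < ?m \<longleftrightarrow> u < 1" by simp
        ultimately show "ennreal ?m * ?g (0 + ?m * u)
            = indicator {0<..<1} u * (of_bool (add_scalar z (- vec_max z) \<le> ?S u x) * ennreal (f z))"
          by (auto simp: zero_less_mult_iff split: split_indicator)
      qed
      finally show "(\<integral>\<^sup>+ t. indicator {0<..} t * (indicator {..?S t x} z * (indicator {..<?m} t * ennreal (\<phi> z))) \<partial>lborel)
        = (\<integral>\<^sup>+ u. indicator {0<..<1} u * (of_bool (add_scalar z (- vec_max z) \<le> ?S u x) * ennreal (f z)) \<partial>lborel)" .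
    qed
    also have "\<dots> = (\<integral>\<^sup>+ u. \<integral>\<^sup>+ z. indicator {0<..<1} u * (of_bool (add_scalar z (- vec_max z) \<le> ?S u x) * ennreal (f z)) \<partial>lborel \<partial>lborel)"
      by (rule lborel_pair.Fubini'[symmetric]) measurable
    also have "\<dots> = (\<integral>\<^sup>+ u. indicator {0<..<1} u * emeasure P {z. add_scalar z (- vec_max z) \<le> ?S u x} \<partial>lborel)"
    proof (intro nn_integral_cong)
      fix u :: real
      have "emeasure P {z. add_scalar z (- vec_max z) \<le> ?S u x}
          = (\<integral>\<^sup>+ z. of_bool (add_scalar z (- vec_max z) \<le> ?S u x) * ennreal (f z) \<partial>lborel)"
        unfolding P_def by (subst emeasure_density) (auto intro!: nn_integral_cong split: split_indicator)
      then show "(\<integral>\<^sup>+ z. indicator {0<..<1} u * (of_bool (add_scalar z (- vec_max z) \<le> ?S u x) * ennreal (f z)) \<partial>lborel)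
          = indicator {0<..<1} u * emeasure P {z. add_scalar z (- vec_max z) \<le> ?S u x}"
        by (simp add: nn_integral_cmult)
    qed
    finally show ?thesis .
  qed
  show ?thesis
    unfolding H_T_def
  proof (rule has_density_the_cdf_on[OF \<sigma> main(1-3)])
    show "h_T \<gamma> \<sigma> f y = 0" if "y \<notin> gp_domain \<gamma> \<sigma>" for y using that by (simp add: h_T_def)
    fix x assume x: "x \<in> gp_domain \<gamma> \<sigma>"
    let ?B = "\<lambda>u. {z. add_scalar z (- vec_max z) \<le> ?S u x}"
    have [measurable]: "(\<lambda>u. emeasure P (?B u)) \<in> borel_measurable borel"
    proof -
      have "Measurable.pred (borel \<Otimes>\<^sub>M P) (\<lambda>(u, z). add_scalar z (- vec_max z) \<le> ?S u x)"
        unfolding add_scalar_def by measurable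
      then have "{p \<in> space (borel \<Otimes>\<^sub>M P). case p of (u, z) \<Rightarrow> add_scalar z (- vec_max z) \<le> ?S u x} \<in> sets (borel \<Otimes>\<^sub>M P)"
        by (rule predE)
      from P.measurable_emeasure_Pair[OF this] show ?thesis
        by (simp add: space_pair_measure vimage_def)
    qed
    have "(LBINT u:{0<..<1}. dist_fun M (spectral T) (?S u x))
        = (LBINT u:{0<..<1}. enn2real (emeasure P (?B u)))"
      by (simp add: dist_fun_spectral[OF assms(1) T f] P_def[symmetric] measure_def)
    also have "\<dots> = enn2real (\<integral>\<^sup>+ u. ennreal (indicator {0<..<1} u *\<^sub>R enn2real (emeasure P (?B u))) \<partial>lborel)"
      unfolding set_lebesgue_integral_def by (rule integral_eq_nn_integral) auto
    also have "\<dots> = enn2real (scaled_mass \<phi> (\<lambda>t. {z. z \<le> ?S t x \<and> \<not> z \<le> ?S t 0}))"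
      unfolding mass
      by (intro arg_cong[where f = enn2real] nn_integral_cong) (auto simp: P.emeasure_eq_measure split: split_indicator)
    finally show "(LBINT u:{0<..<1}. dist_fun M (spectral T) (?S u x))
        = measure (density lborel (\<lambda>y. ennreal (h_T \<gamma> \<sigma> f y))) {..x}"
      using main(4)[OF x] by simp
  qed
qed

section \<open>The three densities\<close>

theorem theorem5:
  fixes \<gamma> \<sigma> :: "real ^ 'd::finite"
    and M :: "'a measure"
    and R U T :: "'a \<Rightarrow> 'd \<Rightarrow> ereal"
    and f\<^sub>R f\<^sub>U f\<^sub>T :: "real ^ 'd \<Rightarrow> real"
  assumes "prob_space M" and "\<And>j. \<sigma> $ j > 0"
  shows "(random_vector M R \<and> R_admissible \<gamma> \<sigma> M R \<and> has_density (dist_fun M R) f\<^sub>R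
            \<longrightarrow> has_density (H_R \<gamma> \<sigma> M R) (h_R \<gamma> \<sigma> (dist_fun M R) f\<^sub>R))
       \<and> (random_vector M U \<and> U_admissible M U \<and> has_density (dist_fun M U) f\<^sub>U
            \<longrightarrow> has_density (H_U \<gamma> \<sigma> M U) (h_U \<gamma> \<sigma> (dist_fun M U) f\<^sub>U))
       \<and> (random_vector M T \<and> has_density (dist_fun M T) f\<^sub>T
            \<longrightarrow> has_density (H_T \<gamma> \<sigma> M T) (h_T \<gamma> \<sigma> f\<^sub>T))"
  using H_R_has_density[OF assms] H_U_has_density[OF assms] H_T_has_density[OF assms] by blast

end
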